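(* Consider the linear program: minimize over $q=(q_{ij})$ $$\sum_{i=1}^r\sum_{j=1}^r\bar f_{ij}+\sum_{i=1}^r\sum_{j\ne i}\bar e_{ij}$$ subject to $$\lambda_iP_{ij}=\mu_{ij}\bar f_{ij}\ (1\le i,j\le r),\qquad\mu_{ij}\bar e_{ij}=q_{ij}\sum_{k=1}^r\mu_{ki}\bar f_{ki}\ (1\le i,j\le r,\ j\ne i),$$ $$\lambda_i=\sum_{k\ne i}\mu_{ki}\bar e_{ki}+q_{ii}\sum_{k=1}^r\mu_{ki}\bar f_{ki}\ (1\le i\le r),\qquad q_{ij}\ge0,\ \sum_{j=1}^rq_{ij}=1\ (1\le i,j\le r).$$ Its feasible region is non-empty. Let $\kappa>0$ be its optimal objective value, and assume that $$\frac1{\mu_{ik}}\le\frac1{\mu_{ij}}+\frac1{\mu_{jk}},\quad 1\le i\ne j\ne k\le r,$$ i.e. the travel time means satisfy the triangle inequality. 1. If $\kappa>1$, then perfect availability is not feasible (for parameters $\lambda,\mu,P$), but it becomes feasible if $\lambda$ is reduced to $\lambda/\kappa$, i.e. under an increase in fleet size by a factor of $\kappa$. 2. If $\kappa\le1$, then perfect availability is feasible (for parameters $\lambda,\mu,P$), and it remains feasible even if $\lambda$ is increased to $\lambda/\kappa$.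
   Context: Fix an integer $r\ge1$, a vector $\lambda=(\lambda_i)$ with $\lambda_i>0$, reals $\mu_{ij}>0$ ($1\le i,j\le r$; $1/\mu_{ij}$ is the mean travel time from region $i$ to region $j$), and an $r\times r$ row-stochastic matrix $P$. In the linear program, $\bar f_{ij}$ ($1\le i,j\le r$) and $\bar e_{ij}$ ($i\ne j$) are determined by $q$ through the first two families of constraints. For a static routing policy, i.e. an $r\times r$ row-stochastic matrix $Q$, and each positive integer $N$ (the number of cars), let $(E^{(N)},F^{(N)})$ be the continuous-time Markov chain on the finite set of pairs $(E,F)\in\mathbb{Z}_+^{r\times r}\times\mathbb{Z}_+^{r\times r}$ with $\sum_{i,j}(E_{ij}+F_{ij})=N$ and transitions: (i) for all $i,j$: at rate $N\lambda_iP_{ij}1(E_{ii}>0)$, $E_{ii}$ decreases by 1 and $F_{ij}$ increases by 1; (ii) for all $i,j,k$: at rate $\mu_{ij}F_{ij}Q_{jk}$, $F_{ij}$ decreases by 1 and $E_{jk}$ increases by 1; (iii) for all $i\ne j$: at rate $\mu_{ij}E_{ij}$, $E_{ij}$ decreases by 1 and $E_{jj}$ increases by 1. It is assumed to have a single recurrent class; $A^{(N)}_i(\infty)$ denotes the stationary probability that $E^{(N)}_{ii}>0$. The system with parameters $\lambda,\mu,P$ achieves perfect availability under $Q$ if $\lim_{N\to\infty}A^{(N)}_i(\infty)=1$ for all $1\le i\le r$. Perfect availability is feasible for parameters $\lambda,\mu,P$ if there exists some row-stochastic $Q$ under which the system achieves perfect availability. Since $\lambda_i$ is the passenger arrival rate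 to region $i$ per car, multiplying the number of cars by $\kappa$ while keeping the total arrival rates $N\lambda_i$ fixed amounts to replacing $\lambda$ by $\lambda/\kappa$. *)

theory Defs
  imports "HOL-Probability.Probability_Mass_Function"
begin

text \<open>The regions are the elements of a finite type \<open>'r\<close>, so that \<open>r = CARD('r) \<ge> 1\<close>.\<close>

definition row_stochastic :: "('r::finite \<Rightarrow> 'r \<Rightarrow> real) \<Rightarrow> bool" where
  "row_stochastic M \<longleftrightarrow> (\<forall>i j. M i j \<ge> 0) \<and> (\<forall>i. (\<Sum>j\<in>UNIV. M i j) = 1)"


section \<open>The Markov chain under a static routing policy\<close>

type_synonym 'r state = "('r \<times> 'r \<Rightarrow> nat) \<times> ('r \<times> 'r \<Rightarrow> nat)"

definition states :: "nat \<Rightarrow> 'r::finite state set" where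
  "states N = {(E, F). (\<Sum>i\<in>UNIV. \<Sum>j\<in>UNIV. E (i, j) + F (i, j)) = N}"

text \<open>
  The effect of the three kinds of transitions. Subtraction on \<^typ>\<open>nat\<close> truncates, but whenever the
  count to be decreased is \<open>0\<close>, the rate of the transition is \<open>0\<close> as well.
\<close>

definition pickup :: "'r \<Rightarrow> 'r \<Rightarrow> 'r state \<Rightarrow> 'r state" where
  "pickup i j = (\<lambda>(E, F). (E((i, i) := E (i, i) - 1), F((i, j) := F (i, j) + 1)))"

definition dropoff :: "'r \<Rightarrow> 'r \<Rightarrow> 'r \<Rightarrow> 'r state \<Rightarrow> 'r state" where
  "dropoff i j k = (\<lambda>(E, F). (E((j, k) := E (j, k) + 1), F((i, j) := F (i, j) - 1)))"

definition empty_arrival :: "'r \<Rightarrow> 'r \<Rightarrow> 'r state \<Rightarrow> 'r state" where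
  "empty_arrival i j =
     (\<lambda>(E, F). (E((i, j) := E (i, j) - 1, (j, j) := E (j, j) + 1), F))"

text \<open>The rate of jumping from \<open>s\<close> to \<open>t\<close> adds up all transitions leading from \<open>s\<close> to \<open>t\<close>.\<close>

definition jump_rate ::
  "('r::finite \<Rightarrow> real) \<Rightarrow> ('r \<Rightarrow> 'r \<Rightarrow> real) \<Rightarrow> ('r \<Rightarrow> 'r \<Rightarrow> real) \<Rightarrow> ('r \<Rightarrow> 'r \<Rightarrow> real) \<Rightarrow> nat
     \<Rightarrow> 'r state \<Rightarrow> 'r state \<Rightarrow> real" where
  "jump_rate lam mu P Q N = (\<lambda>(E, F) t.
       (\<Sum>i\<in>UNIV. \<Sum>j\<in>UNIV.
          if t = pickup i j (E, F)
          then real N * lam i * P i j * of_bool (E (i, i) > 0) else 0)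
     + (\<Sum>i\<in>UNIV. \<Sum>j\<in>UNIV. \<Sum>k\<in>UNIV.
          if t = dropoff i j k (E, F)
          then mu i j * real (F (i, j)) * Q j k else 0)
     + (\<Sum>i\<in>UNIV. \<Sum>j\<in>UNIV - {i}.
          if t = empty_arrival i j (E, F)
          then mu i j * real (E (i, j)) else 0))"

definition accessible ::
  "('r::finite \<Rightarrow> real) \<Rightarrow> ('r \<Rightarrow> 'r \<Rightarrow> real) \<Rightarrow> ('r \<Rightarrow> 'r \<Rightarrow> real) \<Rightarrow> ('r \<Rightarrow> 'r \<Rightarrow> real) \<Rightarrow> nat
     \<Rightarrow> ('r state \<times> 'r state) set" where
  "accessible lam mu P Q N =
     {(s, t). s \<in> states N \<and> t \<in> states N \<and> jump_rate lam mu P Q N s t > 0}\<^sup>*"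

text \<open>As the state space is finite, the recurrent classes are the closed communicating classes.\<close>

definition recurrent_class ::
  "('r::finite \<Rightarrow> real) \<Rightarrow> ('r \<Rightarrow> 'r \<Rightarrow> real) \<Rightarrow> ('r \<Rightarrow> 'r \<Rightarrow> real) \<Rightarrow> ('r \<Rightarrow> 'r \<Rightarrow> real) \<Rightarrow> nat
     \<Rightarrow> 'r state set \<Rightarrow> bool" where
  "recurrent_class lam mu P Q N C \<longleftrightarrow>
     C \<noteq> {} \<and> C \<subseteq> states N \<and>
     (\<forall>s\<in>C. C = {t \<in> states N. (s, t) \<in> accessible lam mu P Q N \<and>
                               (t, s) \<in> accessible lam mu P Q N}) \<and>
     (\<forall>s\<in>C. \<forall>t\<in>states N. jump_rate lam mu P Q N s t > 0 \<longrightarrow> t \<in> C)"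

definition single_recurrent_class ::
  "('r::finite \<Rightarrow> real) \<Rightarrow> ('r \<Rightarrow> 'r \<Rightarrow> real) \<Rightarrow> ('r \<Rightarrow> 'r \<Rightarrow> real) \<Rightarrow> ('r \<Rightarrow> 'r \<Rightarrow> real) \<Rightarrow> nat
     \<Rightarrow> bool" where
  "single_recurrent_class lam mu P Q N \<longleftrightarrow> (\<exists>!C. recurrent_class lam mu P Q N C)"

definition stationary ::
  "('r::finite \<Rightarrow> real) \<Rightarrow> ('r \<Rightarrow> 'r \<Rightarrow> real) \<Rightarrow> ('r \<Rightarrow> 'r \<Rightarrow> real) \<Rightarrow> ('r \<Rightarrow> 'r \<Rightarrow> real) \<Rightarrow> nat
     \<Rightarrow> 'r state pmf \<Rightarrow> bool" where
  "stationary lam mu P Q N p \<longleftrightarrow>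
     set_pmf p \<subseteq> states N \<and>
     (\<forall>t\<in>states N. (\<Sum>s\<in>states N. pmf p s * jump_rate lam mu P Q N s t)
                   = pmf p t * (\<Sum>u\<in>states N. jump_rate lam mu P Q N t u))"

text \<open>Meaningful only if the stationary distribution is unique, as it is for a single recurrent class.\<close>

definition availability ::
  "('r::finite \<Rightarrow> real) \<Rightarrow> ('r \<Rightarrow> 'r \<Rightarrow> real) \<Rightarrow> ('r \<Rightarrow> 'r \<Rightarrow> real) \<Rightarrow> ('r \<Rightarrow> 'r \<Rightarrow> real) \<Rightarrow> nat
     \<Rightarrow> 'r \<Rightarrow> real" where
  "availability lam mu P Q N i =
     measure_pmf.prob (THE p. stationary lam mu P Q N p) {(E, F). E (i, i) > 0}"

definition achieves_perfect_availability ::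
  "('r::finite \<Rightarrow> real) \<Rightarrow> ('r \<Rightarrow> 'r \<Rightarrow> real) \<Rightarrow> ('r \<Rightarrow> 'r \<Rightarrow> real) \<Rightarrow> ('r \<Rightarrow> 'r \<Rightarrow> real)
     \<Rightarrow> bool" where
  "achieves_perfect_availability lam mu P Q \<longleftrightarrow>
     (\<forall>N\<ge>1. single_recurrent_class lam mu P Q N) \<and>
     (\<forall>i. (\<lambda>N. availability lam mu P Q N i) \<longlonglongrightarrow> 1)"

definition perfect_availability_feasible ::
  "('r::finite \<Rightarrow> real) \<Rightarrow> ('r \<Rightarrow> 'r \<Rightarrow> real) \<Rightarrow> ('r \<Rightarrow> 'r \<Rightarrow> real) \<Rightarrow> bool" where
  "perfect_availability_feasible lam mu P \<longleftrightarrow>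
     (\<exists>Q. row_stochastic Q \<and> achieves_perfect_availability lam mu P Q)"


section \<open>The linear program\<close>

text \<open>
  The diagonal entries of \<open>e\<close> are not variables of the program: they occur neither in
  the constraints nor in the objective.
\<close>

definition lp_feasible ::
  "('r::finite \<Rightarrow> real) \<Rightarrow> ('r \<Rightarrow> 'r \<Rightarrow> real) \<Rightarrow> ('r \<Rightarrow> 'r \<Rightarrow> real)
     \<Rightarrow> ('r \<Rightarrow> 'r \<Rightarrow> real) \<Rightarrow> ('r \<Rightarrow> 'r \<Rightarrow> real) \<Rightarrow> ('r \<Rightarrow> 'r \<Rightarrow> real) \<Rightarrow> bool" where
  "lp_feasible lam mu P q f e \<longleftrightarrow>
     (\<forall>i j. lam i * P i j = mu i j * f i j) \<and>
     (\<forall>i j. j \<noteq> i \<longrightarrow> mu i j * e i j = q i j * (\<Sum>k\<in>UNIV. mu k i * f k i)) \<and>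
     (\<forall>i. lam i = (\<Sum>k\<in>UNIV - {i}. mu k i * e k i) + q i i * (\<Sum>k\<in>UNIV. mu k i * f k i)) \<and>
     (\<forall>i j. q i j \<ge> 0) \<and> (\<forall>i. (\<Sum>j\<in>UNIV. q i j) = 1)"

definition lp_objective ::
  "('r::finite \<Rightarrow> 'r \<Rightarrow> real) \<Rightarrow> ('r \<Rightarrow> 'r \<Rightarrow> real) \<Rightarrow> real" where
  "lp_objective f e =
     (\<Sum>i\<in>UNIV. \<Sum>j\<in>UNIV. f i j) + (\<Sum>i\<in>UNIV. \<Sum>j\<in>UNIV - {i}. e i j)"

definition lp_optimal ::
  "('r::finite \<Rightarrow> real) \<Rightarrow> ('r \<Rightarrow> 'r \<Rightarrow> real) \<Rightarrow> ('r \<Rightarrow> 'r \<Rightarrow> real)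
     \<Rightarrow> ('r \<Rightarrow> 'r \<Rightarrow> real) \<Rightarrow> ('r \<Rightarrow> 'r \<Rightarrow> real) \<Rightarrow> ('r \<Rightarrow> 'r \<Rightarrow> real) \<Rightarrow> bool" where
  "lp_optimal lam mu P q f e \<longleftrightarrow>
     lp_feasible lam mu P q f e \<and>
     (\<forall>q' f' e'. lp_feasible lam mu P q' f' e' \<longrightarrow> lp_objective f e \<le> lp_objective f' e')"

definition lp_optimal_value ::
  "('r::finite \<Rightarrow> real) \<Rightarrow> ('r \<Rightarrow> 'r \<Rightarrow> real) \<Rightarrow> ('r \<Rightarrow> 'r \<Rightarrow> real) \<Rightarrow> real \<Rightarrow> bool" where
  "lp_optimal_value lam mu P \<kappa> \<longleftrightarrow>
     (\<exists>q f e. lp_optimal lam mu P q f e \<and> lp_objective f e = \<kappa>)"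

text \<open>
  Availability is defined only for policies whose chain has a single recurrent class, and
  the policies witnessing feasibility are the optimal solutions of the linear program. So
  the assumption of a single recurrent class is imposed on some optimal \<open>q\<close>; this is implied
  by imposing it on all policies. It cannot be dropped: for two regions, the identity matrix
  as \<open>P\<close> and all \<open>lam i\<close> and \<open>mu i j\<close> equal to \<open>1\<close>, the optimal value is \<open>2\<close>, and for
  \<open>lam i = 1 / 2\<close> only \<open>Q\<close> the identity matrix can make all availabilities tend to \<open>1\<close>; but
  then no car ever changes region.
\<close>

definition optimal_policy_single_recurrent_class ::
  "('r::finite \<Rightarrow> real) \<Rightarrow> ('r \<Rightarrow> 'r \<Rightarrow> real) \<Rightarrow> ('r \<Rightarrow> 'r \<Rightarrow> real) \<Rightarrow> bool" where
  "optimal_policy_single_recurrent_class lam mu P \<longleftrightarrow>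
     (\<exists>q f e. lp_optimal lam mu P q f e \<and>
              (\<forall>N\<ge>1. single_recurrent_class lam mu P q N))"

end

theory Submission
  imports Defs "HOL-Analysis.Analysis"
begin

text \<open>
  Under a static policy \<open>Q\<close> the system is a closed queueing network: the cars available at a region form
  a single-server queue, and the cars on a trip form infinite-server queues. Hence the stationary
  distribution has product form, with weights given by a solution \<open>x = x P Q\<close> of the traffic equations,
  and the availability of region \<open>i\<close> is \<open>x i / (N lam i) \<cdot> G (N - 1) / G N\<close>, where \<open>G\<close> is the
  partition function.

  If all availabilities tend to \<open>1\<close>, then \<open>x\<close> is proportional to \<open>lam\<close>, so \<open>Q\<close> is feasible for the
  linear program; and as the mean number of travelling cars is at most \<open>N\<close>, its objective is at most
  \<open>1\<close>. Conversely, let \<open>Q\<close> be feasible with objective \<open>\<rho> \<le> 1\<close>. With \<open>x = N lam\<close>, \<open>G n\<close> is the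
  coefficient of \<open>z ^ n\<close> in \<open>exp (N \<rho> z) / (1 - z) ^ r\<close>, and \<open>G (N - 1) / G N \<longlonglongrightarrow> 1\<close> because the
  probabilities of having \<open>k\<close> and \<open>k + 1\<close> available cars satisfy
  \<open>p (k + 1) \<ge> (1 - k / N) p k\<close>: no bounded number of available cars keeps positive mass.
\<close>

section \<open>Product-form weights\<close>

definition confs :: "nat \<Rightarrow> ('a::finite \<Rightarrow> nat) set" where
  "confs N = {n. sum n UNIV = N}"

text \<open>The unnormalised stationary weight of a closed network: \<open>y a\<close> is the
  throughput of station \<open>a\<close> and \<open>\<phi> a l\<close> its total service rate with
  \<open>l\<close> cars present. The index \<open>Suc l\<close> starts the product at the first car,
  so the rate of an empty station never enters.\<close>

definition weight :: "('a::finite \<Rightarrow> real) \<Rightarrow> ('a \<Rightarrow> nat \<Rightarrow> real) \<Rightarrow> ('a \<Rightarrow> nat) \<Rightarrow> real" where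
  "weight y \<phi> n = (\<Prod>a\<in>UNIV. \<Prod>l<n a. y a / \<phi> a (Suc l))"

lemma finite_confs [simp]: "finite (confs N :: ('a::finite \<Rightarrow> nat) set)"
proof (rule finite_subset)
  show "confs N \<subseteq> PiE (UNIV :: 'a set) (\<lambda>_. {..N})"
  proof
    fix n :: "'a \<Rightarrow> nat" assume "n \<in> confs N"
    then have "n a \<le> N" for a
      using member_le_sum[of a UNIV n] by (simp add: confs_def)
    then show "n \<in> PiE UNIV (\<lambda>_. {..N})" by (auto simp: PiE_def)
  qed
qed (simp add: finite_PiE)

lemma sum_fun_upd_Suc:
  fixes m :: "'a::finite \<Rightarrow> nat"
  shows "sum (m(a := Suc (m a))) UNIV = Suc (sum m UNIV)"
proof -
  have "sum (m(a := Suc (m a))) UNIV = Suc (m a) + sum (m(a := Suc (m a))) (UNIV - {a})"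
    by (subst sum.remove[of UNIV a]) auto
  also have "sum (m(a := Suc (m a))) (UNIV - {a}) = sum m (UNIV - {a})"
    by (rule sum.cong) auto
  finally show ?thesis by (simp add: sum.remove[of UNIV a m])
qed

lemma weight_fun_upd_Suc:
  "weight y \<phi> (m(a := Suc (m a))) = weight y \<phi> m * (y a / \<phi> a (Suc (m a)))"
proof -
  have "weight y \<phi> (m(a := Suc (m a))) =
      (\<Prod>l<Suc (m a). y a / \<phi> a (Suc l)) * (\<Prod>b\<in>UNIV - {a}. \<Prod>l<m b. y b / \<phi> b (Suc l))"
    unfolding weight_def by (subst prod.remove[of UNIV a]) (auto intro!: prod.cong)
  then show ?thesis by (simp add: weight_def prod.remove[of UNIV a])
qed

lemma weight_nonneg:
  assumes "\<And>a. y a \<ge> 0" and "\<And>a l. \<phi> a l \<ge> 0"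
  shows "weight y \<phi> n \<ge> 0"
  unfolding weight_def by (intro prod_nonneg) (simp add: assms)

text \<open>Taking one car out of \<open>a\<close> is a bijection from the configurations of
  \<open>Suc M\<close> cars with \<open>a\<close> occupied onto those of \<open>M\<close> cars, and
  weight times service rate becomes \<open>y a\<close> times the weight of the remaining cars.
  Configurations with \<open>a\<close> empty contribute nothing because
  \<open>\<phi> a 0 = 0\<close>. Every use of the product form rests on this shift.\<close>

lemma sum_confs_shift:
  fixes \<phi> :: "'a::finite \<Rightarrow> nat \<Rightarrow> real"
  assumes "\<phi> a 0 = 0" and "\<And>l. \<phi> a (Suc l) \<noteq> 0"
  shows "(\<Sum>n\<in>confs (Suc M). weight y \<phi> n * \<phi> a (n a) * H n) =
    y a * (\<Sum>m\<in>confs M. weight y \<phi> m * H (m(a := Suc (m a))))"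
proof -
  have "(\<Sum>n\<in>confs (Suc M). weight y \<phi> n * \<phi> a (n a) * H n) =
      (\<Sum>n\<in>{n\<in>confs (Suc M). n a > 0}. weight y \<phi> n * \<phi> a (n a) * H n)"
    using assms(1) by (intro sum.mono_neutral_right) auto
  also have "\<dots> = (\<Sum>m\<in>confs M. y a * (weight y \<phi> m * H (m(a := Suc (m a)))))"
  proof (rule sum.reindex_bij_witness[where i = "\<lambda>m. m(a := Suc (m a))"
        and j = "\<lambda>n. n(a := n a - 1)"])
    fix n assume n: "n \<in> {n\<in>confs (Suc M). n a > 0}"
    let ?m = "n(a := n a - 1)"
    show eq: "?m(a := Suc (?m a)) = n" using n by auto
    have "Suc (sum ?m UNIV) = sum n UNIV"
      using sum_fun_upd_Suc[of ?m a] unfolding eq by simp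
    then show "?m \<in> confs M" using n by (simp add: confs_def)
    have "weight y \<phi> n = weight y \<phi> ?m * (y a / \<phi> a (n a))"
      using weight_fun_upd_Suc[of y \<phi> ?m a] n unfolding eq by simp
    moreover have "\<phi> a (n a) \<noteq> 0" using n assms(2)[of "n a - 1"] by simp
    ultimately show "y a * (weight y \<phi> ?m * H (?m(a := Suc (?m a)))) =
        weight y \<phi> n * \<phi> a (n a) * H n"
      unfolding eq by simp
  next
    fix m assume "m \<in> (confs M :: ('a \<Rightarrow> nat) set)"
    then show "m(a := Suc (m a)) \<in> {n\<in>confs (Suc M). n a > 0}"
      using sum_fun_upd_Suc[of m a] by (simp add: confs_def)
  qed auto
  finally show ?thesis by (simp add: sum_distrib_left)
qed

section \<open>States of the chain as configurations of cars over stations\<close>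

text \<open>A state is read as one function on stations, \<open>Inl\<close> for the entries of
  \<open>E\<close> and \<open>Inr\<close> for those of \<open>F\<close>, so that the general network
  lemmas apply.\<close>

definition conf_of :: "'r state \<Rightarrow> ('r \<times> 'r) + ('r \<times> 'r) \<Rightarrow> nat" where
  "conf_of s = case_sum (fst s) (snd s)"

definition state_of :: "(('r \<times> 'r) + ('r \<times> 'r) \<Rightarrow> nat) \<Rightarrow> 'r state" where
  "state_of n = (n \<circ> Inl, n \<circ> Inr)"

lemma conf_of_state_of [simp]: "conf_of (state_of n) = n"
  by (auto simp: conf_of_def state_of_def fun_eq_iff split: sum.split)

lemma state_of_conf_of [simp]: "state_of (conf_of s) = s"
  by (auto simp: conf_of_def state_of_def fun_eq_iff prod_eq_iff)

lemma conf_of_simps [simp]: "conf_of (E, F) (Inl a) = E a" "conf_of (E, F) (Inr a) = F a"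
  by (simp_all add: conf_of_def)

lemma sum_UNIV_sum:
  fixes f :: "'a::finite + 'b::finite \<Rightarrow> 'c::comm_monoid_add"
  shows "sum f UNIV = (\<Sum>a\<in>UNIV. f (Inl a)) + (\<Sum>b\<in>UNIV. f (Inr b))"
  by (simp add: UNIV_Plus_UNIV[symmetric] sum.Plus del: UNIV_Plus_UNIV)

lemma sum_UNIV_prod:
  fixes f :: "'a::finite \<times> 'b::finite \<Rightarrow> 'c::comm_monoid_add"
  shows "sum f UNIV = (\<Sum>a\<in>UNIV. \<Sum>b\<in>UNIV. f (a, b))"
  by (simp add: UNIV_Times_UNIV[symmetric] sum.cartesian_product del: UNIV_Times_UNIV)

lemma states_iff_confs: "s \<in> states N \<longleftrightarrow> conf_of s \<in> confs N"
  by (cases s) (simp add: states_def confs_def sum_UNIV_sum sum_UNIV_prod sum.distrib)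

lemma states_eq_image: "states N = state_of ` confs N"
proof
  show "states N \<subseteq> state_of ` confs N"
    using states_iff_confs state_of_conf_of by (metis image_eqI subsetI)
qed (auto simp: states_iff_confs)

lemma finite_states [simp]: "finite (states N)"
  by (simp add: states_eq_image)

lemma sum_states_eq_sum_confs: "sum f (states N) = (\<Sum>n\<in>confs N. f (state_of n))"
  unfolding states_eq_image
  by (subst sum.reindex) (auto intro: inj_on_inverseI[of _ conf_of])

text \<open>The diagonal stations \<open>Inl (i, i)\<close> are single-server queues, whose
  customers are the available cars; all other stations are infinite-server. \<open>N\<close> only
  fixes the arrival rates; it is kept apart from the number of cars because the shift compares
  populations \<open>N\<close> and \<open>N - 1\<close> at the same rates.\<close>

definition service_rate ::
  "('r::finite \<Rightarrow> real) \<Rightarrow> ('r \<Rightarrow> 'r \<Rightarrow> real) \<Rightarrow> nat \<Rightarrow> ('r \<times> 'r) + ('r \<times> 'r) \<Rightarrow> nat \<Rightarrow> real" where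
  "service_rate lam mu N a l = (case a of
     Inl (i, j) \<Rightarrow> if i = j then real N * lam i * of_bool (l > 0) else mu i j * real l
   | Inr (i, j) \<Rightarrow> mu i j * real l)"

text \<open>Throughput of each station when region \<open>i\<close> sends off passengers at rate
  \<open>x i\<close>. The inner sum is the rate of drop-offs at \<open>i\<close>. Cars relocating to
  the same region bypass the empty trips, so the diagonal carries the full
  \<open>x i\<close>.\<close>

definition flow ::
  "('r::finite \<Rightarrow> 'r \<Rightarrow> real) \<Rightarrow> ('r \<Rightarrow> 'r \<Rightarrow> real) \<Rightarrow> ('r \<Rightarrow> real) \<Rightarrow> ('r \<times> 'r) + ('r \<times> 'r) \<Rightarrow> real" where
  "flow P Q x a = (case a of
     Inl (i, j) \<Rightarrow> if i = j then x i else (\<Sum>k\<in>UNIV. x k * P k i) * Q i j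
   | Inr (i, j) \<Rightarrow> x i * P i j)"

abbreviation incr :: "('a \<Rightarrow> nat) \<Rightarrow> 'a \<Rightarrow> 'a \<Rightarrow> nat" where
  "incr m a \<equiv> m(a := Suc (m a))"

text \<open>Splitting off the moving car from a configuration \<open>m\<close> of the other cars
  turns a transition into a change of that car's station, and the truncated subtraction
  disappears.\<close>

lemma pickup_incr: "pickup i j (state_of (incr m (Inl (i, i)))) = state_of (incr m (Inr (i, j)))"
  by (auto simp: pickup_def state_of_def fun_eq_iff)

lemma dropoff_incr: "dropoff i j k (state_of (incr m (Inr (i, j)))) = state_of (incr m (Inl (j, k)))"
  by (auto simp: dropoff_def state_of_def fun_eq_iff)

lemma empty_arrival_incr:
  "i \<noteq> j \<Longrightarrow>
    empty_arrival i j (state_of (incr m (Inl (i, j)))) = state_of (incr m (Inl (j, j)))"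
  by (auto simp: empty_arrival_def state_of_def fun_eq_iff)

text \<open>Several transitions may share a target, so \<open>jump_rate\<close> is a sum of
  indicators. Summing it against a test function returns to a sum over transitions, since each
  transition of nonzero rate conserves the number of cars and its target lies in
  \<open>states N\<close>.\<close>

lemma sum_jump_rate:
  assumes s: "(E, F) \<in> states N"
  shows "(\<Sum>t\<in>states N. jump_rate lam mu P Q N (E, F) t * g t) =
     (\<Sum>i\<in>UNIV. \<Sum>j\<in>UNIV. real N * lam i * P i j * of_bool (E (i, i) > 0) * g (pickup i j (E, F)))
   + (\<Sum>i\<in>UNIV. \<Sum>j\<in>UNIV. \<Sum>k\<in>UNIV. mu i j * real (F (i, j)) * Q j k * g (dropoff i j k (E, F)))
   + (\<Sum>i\<in>UNIV. \<Sum>j\<in>UNIV - {i}. mu i j * real (E (i, j)) * g (empty_arrival i j (E, F)))"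
proof -
  have move: "T (E, F) \<in> states N"
    if pos: "conf_of (E, F) a > 0"
      and T: "\<And>m. T (state_of (incr m a)) = state_of (incr m b)" for a b T
  proof -
    define m where "m = (conf_of (E, F))(a := conf_of (E, F) a - 1)"
    have m: "incr m a = conf_of (E, F)" using pos by (auto simp: m_def)
    have "T (E, F) = state_of (incr m b)"
      using T[of m] unfolding m by simp
    with m s show ?thesis
      by (metis conf_of_state_of confs_def mem_Collect_eq states_iff_confs sum_fun_upd_Suc)
  qed
  \<comment> \<open>Membership of the target is required only for nonzero rate: truncation may push
    the target of an impossible transition out of \<open>states N\<close>.\<close>
  have pull: "(\<Sum>t\<in>states N. (if t = u then c else 0) * g t) = c * g u"
    if "c \<noteq> 0 \<Longrightarrow> u \<in> states N" for c u
  proof -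
    have "(\<Sum>t\<in>states N. (if t = u then c else 0) * g t) =
        (\<Sum>t\<in>states N. if t = u then c * g u else 0)"
      by (rule sum.cong) auto
    then show ?thesis using that by (auto simp: sum.delta)
  qed
  have 1: "(\<Sum>t\<in>states N. (if t = pickup i j (E, F)
          then real N * lam i * P i j * of_bool (E (i, i) > 0) else 0) * g t) =
      real N * lam i * P i j * of_bool (E (i, i) > 0) * g (pickup i j (E, F))" for i j
    by (rule pull, rule move[of "Inl (i, i)" _ "Inr (i, j)"])
      (auto simp: pickup_incr)
  have 2: "(\<Sum>t\<in>states N. (if t = dropoff i j k (E, F)
          then mu i j * real (F (i, j)) * Q j k else 0) * g t) =
      mu i j * real (F (i, j)) * Q j k * g (dropoff i j k (E, F))" for i j k
    by (rule pull, rule move[of "Inr (i, j)" _ "Inl (j, k)"])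
      (auto simp: dropoff_incr)
  have 3: "(\<Sum>t\<in>states N. (if t = empty_arrival i j (E, F)
          then mu i j * real (E (i, j)) else 0) * g t) =
      mu i j * real (E (i, j)) * g (empty_arrival i j (E, F))" if "j \<in> UNIV - {i}" for i j
    by (rule pull, rule move[of "Inl (i, j)" _ "Inl (j, j)"])
      (use that in \<open>auto simp: empty_arrival_incr\<close>)
  have swap1: "(\<Sum>t\<in>states N. (\<Sum>i\<in>A. f i t) * g t) = (\<Sum>i\<in>A. \<Sum>t\<in>states N. f i t * g t)"
    for f :: "'b \<Rightarrow> 'a state \<Rightarrow> real" and A
    by (simp add: sum_distrib_right) (rule sum.swap)
  show ?thesis
    unfolding jump_rate_def prod.case distrib_right sum.distrib swap1
    by (intro arg_cong2[of _ _ _ _ "(+)"] sum.cong refl 1 2 3)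
qed

section \<open>Global balance for the product form\<close>

abbreviation state_weight where
  "state_weight lam mu P Q x N s \<equiv> weight (flow P Q x) (service_rate lam mu N) (conf_of s)"

lemma sum_states_shift:
  assumes lam: "\<And>i. lam i > 0" and mu: "\<And>i j. mu i j > 0"
  shows "(\<Sum>s\<in>states (Suc M). state_weight lam mu P Q x (Suc M) s *
        service_rate lam mu (Suc M) a (conf_of s a) * H s) =
     flow P Q x a * (\<Sum>s\<in>states M. state_weight lam mu P Q x (Suc M) s * H (state_of (incr (conf_of s) a)))"
  unfolding sum_states_eq_sum_confs conf_of_state_of
  by (rule sum_confs_shift)
    (use lam mu in \<open>auto simp: service_rate_def less_imp_neq[symmetric] split: sum.splits\<close>)

text \<open>The test function \<open>G\<close> sees both ends of a jump, so one computation yields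
  the flow into a state as well as the flow out of it. By the shift, each kind of transition becomes
  a throughput times a sum over the positions of the other \<open>M\<close> cars.\<close>

lemma sum_states_weight_jump_rate:
  fixes P Q mu :: "'r::finite \<Rightarrow> 'r \<Rightarrow> real" and lam x :: "'r \<Rightarrow> real" and M :: nat
  assumes lam: "\<And>i. lam i > 0" and mu: "\<And>i j. mu i j > 0"
  defines "S \<equiv> \<lambda>G a b. \<Sum>s\<in>states M. state_weight lam mu P Q x (Suc M) s *
     G (state_of (incr (conf_of s) a)) (state_of (incr (conf_of s) b))"
  shows "(\<Sum>s\<in>states (Suc M). state_weight lam mu P Q x (Suc M) s *
       (\<Sum>t\<in>states (Suc M). jump_rate lam mu P Q (Suc M) s t * G s t)) =
     (\<Sum>i\<in>UNIV. \<Sum>j\<in>UNIV. P i j * (x i * S G (Inl (i, i)) (Inr (i, j))))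
   + (\<Sum>i\<in>UNIV. \<Sum>j\<in>UNIV. \<Sum>k\<in>UNIV. Q j k * (x i * P i j * S G (Inr (i, j)) (Inl (j, k))))
   + (\<Sum>i\<in>UNIV. \<Sum>j\<in>UNIV - {i}. (\<Sum>k\<in>UNIV. x k * P k i) * Q i j * S G (Inl (i, j)) (Inl (j, j)))"
proof -
  define w where "w s = state_weight lam mu P Q x (Suc M) s" for s
  note shift = sum_states_shift[OF lam mu, where M = M and P = P and Q = Q and x = x, folded w_def]
  have 1: "(\<Sum>s\<in>states (Suc M). w s *
        (real (Suc M) * lam i * P i j * of_bool (fst s (i, i) > 0) * G s (pickup i j s))) =
      P i j * (x i * S G (Inl (i, i)) (Inr (i, j)))" for i j
  proof -
    have "(\<Sum>s\<in>states (Suc M). w s *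
        (real (Suc M) * lam i * P i j * of_bool (fst s (i, i) > 0) * G s (pickup i j s))) =
      P i j * (\<Sum>s\<in>states (Suc M). w s * service_rate lam mu (Suc M) (Inl (i, i)) (conf_of s (Inl (i, i)))
         * G s (pickup i j s))"
      unfolding sum_distrib_left
      by (intro sum.cong) (auto simp: service_rate_def conf_of_def)
    then show ?thesis unfolding shift pickup_incr S_def w_def by (simp add: flow_def)
  qed
  have 2: "(\<Sum>s\<in>states (Suc M). w s *
        (mu i j * real (snd s (i, j)) * Q j k * G s (dropoff i j k s))) =
      Q j k * (x i * P i j * S G (Inr (i, j)) (Inl (j, k)))" for i j k
  proof -
    have "(\<Sum>s\<in>states (Suc M). w s *
        (mu i j * real (snd s (i, j)) * Q j k * G s (dropoff i j k s))) =
      Q j k * (\<Sum>s\<in>states (Suc M). w s * service_rate lam mu (Suc M) (Inr (i, j)) (conf_of s (Inr (i, j)))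
         * G s (dropoff i j k s))"
      unfolding sum_distrib_left
      by (intro sum.cong) (auto simp: service_rate_def conf_of_def)
    then show ?thesis unfolding shift dropoff_incr S_def w_def by (simp add: flow_def)
  qed
  have 3: "(\<Sum>s\<in>states (Suc M). w s *
        (mu i j * real (fst s (i, j)) * G s (empty_arrival i j s))) =
      (\<Sum>k\<in>UNIV. x k * P k i) * Q i j * S G (Inl (i, j)) (Inl (j, j))" if "j \<in> UNIV - {i}" for i j
  proof -
    have "(\<Sum>s\<in>states (Suc M). w s *
        (mu i j * real (fst s (i, j)) * G s (empty_arrival i j s))) =
      (\<Sum>s\<in>states (Suc M). w s * service_rate lam mu (Suc M) (Inl (i, j)) (conf_of s (Inl (i, j)))
         * G s (empty_arrival i j s))"
      using that by (intro sum.cong) (auto simp: service_rate_def conf_of_def)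
    then show ?thesis
      unfolding shift S_def w_def using that by (auto simp: flow_def empty_arrival_incr)
  qed
  have swap: "(\<Sum>s\<in>A. w s * (\<Sum>i\<in>B. f i s)) = (\<Sum>i\<in>B. \<Sum>s\<in>A. w s * f i s)"
    for f :: "'b \<Rightarrow> 'r state \<Rightarrow> real" and A B
    by (simp add: sum_distrib_left) (rule sum.swap)
  have "(\<Sum>s\<in>states (Suc M). w s *
       (\<Sum>t\<in>states (Suc M). jump_rate lam mu P Q (Suc M) s t * G s t)) =
     (\<Sum>s\<in>states (Suc M). w s *
      ((\<Sum>i\<in>UNIV. \<Sum>j\<in>UNIV. real (Suc M) * lam i * P i j * of_bool (fst s (i, i) > 0) * G s (pickup i j s))
     + (\<Sum>i\<in>UNIV. \<Sum>j\<in>UNIV. \<Sum>k\<in>UNIV. mu i j * real (snd s (i, j)) * Q j k * G s (dropoff i j k s))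
     + (\<Sum>i\<in>UNIV. \<Sum>j\<in>UNIV - {i}. mu i j * real (fst s (i, j)) * G s (empty_arrival i j s))))"
    (is "_ = ?R")
  proof (rule sum.cong[OF refl])
    fix s :: "'r state" assume s: "s \<in> states (Suc M)"
    have "(fst s, snd s) \<in> states (Suc M)" using s by simp
    from sum_jump_rate[OF this, of lam mu P Q "G s"] show "w s * (\<Sum>t\<in>states (Suc M). jump_rate lam mu P Q (Suc M) s t * G s t) = w s *
      ((\<Sum>i\<in>UNIV. \<Sum>j\<in>UNIV. real (Suc M) * lam i * P i j * of_bool (fst s (i, i) > 0) * G s (pickup i j s))
     + (\<Sum>i\<in>UNIV. \<Sum>j\<in>UNIV. \<Sum>k\<in>UNIV. mu i j * real (snd s (i, j)) * Q j k * G s (dropoff i j k s))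
     + (\<Sum>i\<in>UNIV. \<Sum>j\<in>UNIV - {i}. mu i j * real (fst s (i, j)) * G s (empty_arrival i j s)))"
      by simp
  qed
  also have "?R = (\<Sum>i\<in>UNIV. \<Sum>j\<in>UNIV. P i j * (x i * S G (Inl (i, i)) (Inr (i, j))))
   + (\<Sum>i\<in>UNIV. \<Sum>j\<in>UNIV. \<Sum>k\<in>UNIV. Q j k * (x i * P i j * S G (Inr (i, j)) (Inl (j, k))))
   + (\<Sum>i\<in>UNIV. \<Sum>j\<in>UNIV - {i}. (\<Sum>k\<in>UNIV. x k * P k i) * Q i j * S G (Inl (i, j)) (Inl (j, j)))"
    unfolding distrib_left sum.distrib swap
    by (intro arg_cong2[of _ _ _ _ "(+)"] sum.cong refl 1 2 3)
  finally show ?thesis unfolding w_def .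
qed

text \<open>With one car moving and the others fixed, balance holds station by station: throughput
  in equals throughput out. For passenger trips and off-diagonal empty trips this is built into
  \<open>flow\<close>; for the available cars of a region it is the traffic equation.\<close>

lemma product_form_balance:
  assumes lam: "\<And>i. lam i > 0" and mu: "\<And>i j. mu i j > 0"
    and P: "row_stochastic P" and Q: "row_stochastic Q"
    and traffic: "\<And>i. x i = (\<Sum>j\<in>UNIV. (\<Sum>k\<in>UNIV. x k * P k j) * Q j i)"
    and t: "t \<in> states (Suc M)"
  shows "(\<Sum>s\<in>states (Suc M). state_weight lam mu P Q x (Suc M) s * jump_rate lam mu P Q (Suc M) s t) =
     state_weight lam mu P Q x (Suc M) t * (\<Sum>u\<in>states (Suc M). jump_rate lam mu P Q (Suc M) t u)"
proof -
  define w where "w s = state_weight lam mu P Q x (Suc M) s" for s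
  \<comment> \<open>The weight of those placements of the other \<open>M\<close> cars that become
    \<open>t\<close> when the moving car is put at \<open>b\<close>.\<close>
  define Z where "Z b = (\<Sum>s\<in>states M. w s * of_bool (state_of (incr (conf_of s) b) = t))"
    for b :: "('a \<times> 'a) + ('a \<times> 'a)"
  define a where "a i = (\<Sum>k\<in>UNIV. x k * P k i)" for i
  have row_avg: "(\<Sum>j\<in>UNIV. P i j * c) = c" "(\<Sum>j\<in>UNIV. Q i j * c) = c" for i c
    using P Q by (simp_all add: row_stochastic_def sum_distrib_right[symmetric])
  have traffic_a: "(\<Sum>j\<in>UNIV. a j * Q j i) = x i" for i
    unfolding a_def by (rule traffic[symmetric])
  have split_diag: "(\<Sum>i\<in>UNIV. \<Sum>j\<in>UNIV. f i j) = (\<Sum>i\<in>UNIV. f i i) + (\<Sum>i\<in>UNIV. \<Sum>j\<in>UNIV - {i}. f i j)"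
    for f :: "'a \<Rightarrow> 'a \<Rightarrow> real"
  proof -
    have "(\<Sum>j\<in>UNIV. f i j) = f i i + (\<Sum>j\<in>UNIV - {i}. f i j)" for i
      by (rule sum.remove) auto
    then show ?thesis by (simp add: sum.distrib)
  qed
  have swap_off: "(\<Sum>i\<in>UNIV. \<Sum>j\<in>UNIV - {i}. f i j) = (\<Sum>j\<in>UNIV. \<Sum>i\<in>UNIV - {j}. f i j)"
    for f :: "'a \<Rightarrow> 'a \<Rightarrow> real"
  proof -
    have "(\<Sum>i\<in>UNIV. \<Sum>j\<in>UNIV. f i j) = (\<Sum>j\<in>UNIV. \<Sum>i\<in>UNIV. f i j)" by (rule sum.swap)
    then show ?thesis
      using split_diag[of f] split_diag[of "\<lambda>j i. f i j"] by simp
  qed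
  have through_F: "(\<Sum>i\<in>UNIV. \<Sum>j\<in>UNIV. \<Sum>k\<in>UNIV. Q j k * (x i * P i j * f j k)) =
      (\<Sum>j\<in>UNIV. \<Sum>k\<in>UNIV. a j * Q j k * f j k)" for f
  proof -
    have "(\<Sum>i\<in>UNIV. \<Sum>j\<in>UNIV. \<Sum>k\<in>UNIV. Q j k * (x i * P i j * f j k)) =
       (\<Sum>j\<in>UNIV. \<Sum>i\<in>UNIV. \<Sum>k\<in>UNIV. Q j k * (x i * P i j * f j k))" by (rule sum.swap)
    also have "\<dots> = (\<Sum>j\<in>UNIV. \<Sum>k\<in>UNIV. \<Sum>i\<in>UNIV. Q j k * (x i * P i j * f j k))"
      by (rule sum.cong[OF refl], rule sum.swap)
    also have "\<dots> = (\<Sum>j\<in>UNIV. \<Sum>k\<in>UNIV. a j * Q j k * f j k)"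
      by (simp add: a_def sum_distrib_right sum_distrib_left mult_ac)
    finally show ?thesis .
  qed
  have "(\<Sum>s\<in>states (Suc M). w s * jump_rate lam mu P Q (Suc M) s t) =
      (\<Sum>s\<in>states (Suc M). w s *
        (\<Sum>u\<in>states (Suc M). jump_rate lam mu P Q (Suc M) s u * of_bool (u = t)))"
  proof (rule sum.cong[OF refl])
    fix s
    have "(\<Sum>u\<in>states (Suc M). jump_rate lam mu P Q (Suc M) s u * of_bool (u = t)) =
        (\<Sum>u\<in>states (Suc M). if u = t then jump_rate lam mu P Q (Suc M) s t else 0)"
      by (rule sum.cong) auto
    then show "w s * jump_rate lam mu P Q (Suc M) s t = w s *
        (\<Sum>u\<in>states (Suc M). jump_rate lam mu P Q (Suc M) s u * of_bool (u = t))"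
      using t by (simp add: sum.delta)
  qed
  also have "\<dots> = (\<Sum>i\<in>UNIV. \<Sum>j\<in>UNIV. P i j * (x i * Z (Inr (i, j)))) +
      (\<Sum>i\<in>UNIV. \<Sum>j\<in>UNIV. \<Sum>k\<in>UNIV. Q j k * (x i * P i j * Z (Inl (j, k)))) +
      (\<Sum>i\<in>UNIV. \<Sum>j\<in>UNIV - {i}. a i * Q i j * Z (Inl (j, j)))"
    unfolding w_def a_def Z_def by (subst sum_states_weight_jump_rate[OF lam mu, where G = "\<lambda>s u. of_bool (u = t)"]) (rule refl)
  \<comment> \<open>Drop-offs assigned to their own region move from the second sum to the third,
    which then collects all arrivals at the queue of region \<open>i\<close>.\<close>
  also have "\<dots> = (\<Sum>i\<in>UNIV. \<Sum>j\<in>UNIV. P i j * (x i * Z (Inr (i, j)))) +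
      (\<Sum>i\<in>UNIV. \<Sum>j\<in>UNIV - {i}. a i * Q i j * Z (Inl (i, j))) +
      (\<Sum>i\<in>UNIV. \<Sum>j\<in>UNIV. a j * Q j i * Z (Inl (i, i)))"
    unfolding through_F swap_off[of "\<lambda>i j. a i * Q i j * Z (Inl (j, j))"]
    using split_diag[of "\<lambda>i j. a i * Q i j * Z (Inl (i, j))"]
      split_diag[of "\<lambda>i j. a j * Q j i * Z (Inl (i, i))"] by linarith
  also have "(\<Sum>i\<in>UNIV. \<Sum>j\<in>UNIV. a j * Q j i * Z (Inl (i, i))) = (\<Sum>i\<in>UNIV. x i * Z (Inl (i, i)))"
    by (simp only: sum_distrib_right[symmetric] traffic_a)
  also have "(\<Sum>i\<in>UNIV. x i * Z (Inl (i, i))) =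
      (\<Sum>i\<in>UNIV. \<Sum>j\<in>UNIV. P i j * (x i * Z (Inl (i, i))))"
    by (simp only: row_avg)
  \<comment> \<open>Row sums equal to one are inserted to give the inflow the shape of the outflow:
    here every pickup is split according to the later drop-off.\<close>
  also have "(\<Sum>i\<in>UNIV. \<Sum>j\<in>UNIV. P i j * (x i * Z (Inr (i, j)))) =
      (\<Sum>i\<in>UNIV. \<Sum>j\<in>UNIV. \<Sum>k\<in>UNIV. Q j k * (x i * P i j * Z (Inr (i, j))))"
    by (simp only: row_avg) (simp only: mult_ac)
  also have "(\<Sum>i\<in>UNIV. \<Sum>j\<in>UNIV. \<Sum>k\<in>UNIV. Q j k * (x i * P i j * Z (Inr (i, j)))) +
      (\<Sum>i\<in>UNIV. \<Sum>j\<in>UNIV - {i}. a i * Q i j * Z (Inl (i, j))) +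
      (\<Sum>i\<in>UNIV. \<Sum>j\<in>UNIV. P i j * (x i * Z (Inl (i, i)))) =
      (\<Sum>s\<in>states (Suc M). w s *
        (\<Sum>u\<in>states (Suc M). jump_rate lam mu P Q (Suc M) s u * of_bool (s = t)))"
    unfolding w_def a_def Z_def by (subst sum_states_weight_jump_rate[OF lam mu, where G = "\<lambda>s u. of_bool (s = t)"]) (simp only: add_ac)
  also have "\<dots> = w t * (\<Sum>u\<in>states (Suc M). jump_rate lam mu P Q (Suc M) t u)"
  proof -
    have "(\<Sum>s\<in>states (Suc M). w s *
        (\<Sum>u\<in>states (Suc M). jump_rate lam mu P Q (Suc M) s u * of_bool (s = t))) =
        (\<Sum>s\<in>states (Suc M). if s = t then
           w t * (\<Sum>u\<in>states (Suc M). jump_rate lam mu P Q (Suc M) t u) else 0)"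
      by (rule sum.cong) auto
    then show ?thesis using t by (simp add: sum.delta)
  qed
  finally show ?thesis unfolding w_def .
qed

section \<open>Uniqueness of the stationary distribution\<close>

lemma jump_rate_nonneg:
  assumes "\<And>i. lam i \<ge> 0" and "\<And>i j. mu i j \<ge> 0" and "row_stochastic P" and "row_stochastic Q"
  shows "jump_rate lam mu P Q N s t \<ge> 0"
proof -
  obtain E F where s: "s = (E, F)" by (cases s)
  have PQ: "P i j \<ge> 0" "Q i j \<ge> 0" for i j using assms(3,4) by (auto simp: row_stochastic_def)
  show ?thesis
    unfolding s jump_rate_def prod.case
    by (intro add_nonneg_nonneg sum_nonneg) (simp_all add: assms(1,2) PQ)
qed

text \<open>Choose a state of \<open>C\<close> whose set of reachable states has least cardinality.
  Any state it reaches can reach no more, hence by minimality exactly as much, so that set is a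
  closed communicating class.\<close>

lemma recurrent_class_in_closed_set:
  assumes "C \<subseteq> states N" and "C \<noteq> {}"
    and closed: "\<And>s t. s \<in> C \<Longrightarrow> t \<in> states N \<Longrightarrow> jump_rate lam mu P Q N s t > 0 \<Longrightarrow> t \<in> C"
  obtains D where "D \<subseteq> C" and "recurrent_class lam mu P Q N D"
proof -
  let ?R = "{(s, t). s \<in> states N \<and> t \<in> states N \<and> jump_rate lam mu P Q N s t > 0}"
  define reach where "reach s = {t. (s, t) \<in> ?R\<^sup>*}" for s
  have reach_C: "reach s \<subseteq> C" if "s \<in> C" for s
  proof
    fix t assume "t \<in> reach s"
    then have "(s, t) \<in> ?R\<^sup>*" by (simp add: reach_def)
    then show "t \<in> C" by induction (use that closed in auto)
  qed
  have reach_mono: "reach t \<subseteq> reach s" if "t \<in> reach s" for s t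
    using that by (auto simp: reach_def)
  have reach_refl: "s \<in> reach s" for s by (simp add: reach_def)
  have fin: "finite (reach s)" if "s \<in> C" for s
    by (rule finite_subset[OF _ finite_states[of N]]) (use reach_C[OF that] assms(1) in blast)
  obtain s where s: "s \<in> C" and min: "\<And>t. t \<in> C \<Longrightarrow> card (reach s) \<le> card (reach t)"
    using assms(2) ex_has_least_nat[of "\<lambda>s. s \<in> C" _ "\<lambda>s. card (reach s)"] by blast
  have same: "reach t = reach s" if "t \<in> reach s" for t
  proof (rule card_seteq[OF fin[OF s] reach_mono[OF that]])
    show "card (reach s) \<le> card (reach t)"
      using that reach_C[OF s] by (intro min) blast
  qed
  have "recurrent_class lam mu P Q N (reach s)"
    unfolding recurrent_class_def accessible_def
  proof (intro conjI ballI impI)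
    show "reach s \<noteq> {}" using reach_refl by blast
    show "reach s \<subseteq> states N" using reach_C[OF s] assms(1) by blast
  next
    fix u assume u: "u \<in> reach s"
    show "reach s = {t \<in> states N. (u, t) \<in> ?R\<^sup>* \<and> (t, u) \<in> ?R\<^sup>*}"
    proof (intro set_eqI iffI)
      fix t assume t: "t \<in> reach s"
      have "t \<in> reach u" "u \<in> reach t" using same t u by auto
      then show "t \<in> {t \<in> states N. (u, t) \<in> ?R\<^sup>* \<and> (t, u) \<in> ?R\<^sup>*}"
        using t reach_C[OF s] assms(1) by (auto simp: reach_def)
    next
      fix t assume "t \<in> {t \<in> states N. (u, t) \<in> ?R\<^sup>* \<and> (t, u) \<in> ?R\<^sup>*}"
      then have "t \<in> reach u" by (simp add: reach_def)
      then show "t \<in> reach s" using same[OF u] by simp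
    qed
  next
    fix u t assume u: "u \<in> reach s" and t: "t \<in> states N" "jump_rate lam mu P Q N u t > 0"
    have "u \<in> states N" using u reach_C[OF s] assms(1) by blast
    then have "(u, t) \<in> ?R" using t by blast
    then show "t \<in> reach s" using u by (auto simp: reach_def intro: rtrancl.rtrancl_into_rtrancl)
  qed
  with that reach_C[OF s] show thesis by blast
qed

text \<open>By the triangle inequality the inflow of \<open>\<bar>d\<bar>\<close> is at least its
  outflow at every state. Summed over \<open>S\<close> both totals agree, so no inequality can be
  strict.\<close>

lemma abs_invariant:
  fixes d :: "'a \<Rightarrow> real" and r :: "'a \<Rightarrow> 'a \<Rightarrow> real"
  assumes "finite S" and r: "\<And>s t. r s t \<ge> 0"
    and inv: "\<And>t. t \<in> S \<Longrightarrow> (\<Sum>s\<in>S. d s * r s t) = d t * (\<Sum>u\<in>S. r t u)"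
    and t: "t \<in> S"
  shows "(\<Sum>s\<in>S. \<bar>d s\<bar> * r s t) = \<bar>d t\<bar> * (\<Sum>u\<in>S. r t u)"
proof -
  let ?f = "\<lambda>t. (\<Sum>s\<in>S. \<bar>d s\<bar> * r s t) - \<bar>d t\<bar> * (\<Sum>u\<in>S. r t u)"
  have "?f t \<ge> 0" if "t \<in> S" for t
  proof -
    have "\<bar>d t\<bar> * (\<Sum>u\<in>S. r t u) = \<bar>\<Sum>s\<in>S. d s * r s t\<bar>"
      using inv[OF that] r by (simp add: abs_mult sum_nonneg)
    also have "\<dots> \<le> (\<Sum>s\<in>S. \<bar>d s * r s t\<bar>)" by (rule sum_abs)
    finally show ?thesis using r by (simp add: abs_mult)
  qed
  moreover have "(\<Sum>t\<in>S. ?f t) = 0"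
  proof -
    have "(\<Sum>t\<in>S. \<Sum>s\<in>S. \<bar>d s\<bar> * r s t) = (\<Sum>s\<in>S. \<Sum>t\<in>S. \<bar>d s\<bar> * r s t)"
      by (rule sum.swap)
    then show ?thesis by (simp add: sum_subtractf sum_distrib_left)
  qed
  ultimately have "?f t = 0" using t sum_nonneg_eq_0_iff[OF assms(1), of ?f] by blast
  then show ?thesis by simp
qed

text \<open>A state with zero mass has zero outflow, hence zero inflow, so no jump from positive
  mass can enter it.\<close>

lemma closed_support:
  fixes d :: "'a \<Rightarrow> real" and r :: "'a \<Rightarrow> 'a \<Rightarrow> real"
  assumes "finite S" and r: "\<And>s t. r s t \<ge> 0" and d: "\<And>s. d s \<ge> 0"
    and inv: "\<And>t. t \<in> S \<Longrightarrow> (\<Sum>s\<in>S. d s * r s t) = d t * (\<Sum>u\<in>S. r t u)"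
    and "s \<in> S" "t \<in> S" "d s > 0" "r s t > 0"
  shows "d t > 0"
proof -
  have "0 < d s * r s t" using assms by simp
  also have "\<dots> \<le> (\<Sum>s\<in>S. d s * r s t)"
    by (rule member_le_sum) (use assms in auto)
  finally show ?thesis using inv[of t] \<open>t \<in> S\<close> d[of t] by (cases "d t = 0") auto
qed

text \<open>If two stationary distributions differed, the positive and the negative part of their
  difference would both be invariant and nonzero. Their supports are closed and disjoint, so each
  would contain its own recurrent class.\<close>

lemma stationary_unique:
  assumes lam: "\<And>i. lam i > 0" and mu: "\<And>i j. mu i j > 0"
    and P: "row_stochastic P" and Q: "row_stochastic Q"
    and single: "single_recurrent_class lam mu P Q N"
    and p: "stationary lam mu P Q N p" and q: "stationary lam mu P Q N q"
  shows "p = q"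
proof -
  define r where "r = jump_rate lam mu P Q N"
  define d where "d s = pmf p s - pmf q s" for s
  have r: "r s t \<ge> 0" for s t
    unfolding r_def using lam mu P Q by (intro jump_rate_nonneg) (auto intro: less_imp_le)
  have supp: "set_pmf p \<subseteq> states N" "set_pmf q \<subseteq> states N"
    using p q by (auto simp: stationary_def)
  have inv: "(\<Sum>s\<in>states N. d s * r s t) = d t * (\<Sum>u\<in>states N. r t u)" if "t \<in> states N" for t
  proof -
    have "(\<Sum>s\<in>states N. pmf p s * r s t) = pmf p t * (\<Sum>u\<in>states N. r t u)"
      "(\<Sum>s\<in>states N. pmf q s * r s t) = pmf q t * (\<Sum>u\<in>states N. r t u)"
      using p q that unfolding stationary_def r_def by blast+
    then show ?thesis by (simp add: d_def left_diff_distrib sum_subtractf)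
  qed
  have sum_d: "(\<Sum>s\<in>states N. d s) = 0"
    using sum_pmf_eq_1[OF finite_states supp(1)] sum_pmf_eq_1[OF finite_states supp(2)]
    by (simp add: d_def sum_subtractf)
  have half: "\<exists>D. D \<subseteq> {s\<in>states N. c * d s > 0} \<and> recurrent_class lam mu P Q N D"
    if "s\<^sub>0 \<in> states N" "c * d s\<^sub>0 > 0" and c: "c = 1 \<or> c = -1" for c :: real and s\<^sub>0
  proof -
    \<comment> \<open>Twice the positive part of \<open>d\<close> for \<open>c = 1\<close>, twice
      the negative part for \<open>c = -1\<close>.\<close>
    define h where "h s = \<bar>d s\<bar> + c * d s" for s
    have h: "h s \<ge> 0" "h s > 0 \<longleftrightarrow> c * d s > 0" for s using c by (auto simp: h_def)
    have inv_h: "(\<Sum>s\<in>states N. h s * r s t) = h t * (\<Sum>u\<in>states N. r t u)" if "t \<in> states N" for t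
    proof -
      have abs: "(\<Sum>s\<in>states N. \<bar>d s\<bar> * r s t) = \<bar>d t\<bar> * (\<Sum>u\<in>states N. r t u)"
        by (rule abs_invariant[where d = d and r = r, OF finite_states _ _ that]) (fact r inv)+
      have "(\<Sum>s\<in>states N. h s * r s t) =
          (\<Sum>s\<in>states N. \<bar>d s\<bar> * r s t) + c * (\<Sum>s\<in>states N. d s * r s t)"
        by (simp add: h_def distrib_right sum.distrib sum_distrib_left mult.assoc)
      also have "\<dots> = h t * (\<Sum>u\<in>states N. r t u)"
        using abs inv[OF that] by (simp add: h_def distrib_right)
      finally show ?thesis .
    qed
    have cl: "t \<in> {s\<in>states N. c * d s > 0}"
      if "s \<in> {s\<in>states N. c * d s > 0}" "t \<in> states N" "jump_rate lam mu P Q N s t > 0" for s t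
    proof -
      have "h t > 0"
        by (rule closed_support[where d = h and r = r, OF finite_states r h(1) inv_h, of s t])
          (use that h(2) in \<open>auto simp: r_def\<close>)
      then show ?thesis using that(2) h(2) by blast
    qed
    let ?C = "{s\<in>states N. c * d s > 0}"
    have "?C \<subseteq> states N" "?C \<noteq> {}" using that(1,2) by blast+
    then obtain D where "D \<subseteq> ?C" "recurrent_class lam mu P Q N D"
    proof (rule recurrent_class_in_closed_set)
      show "t \<in> ?C" if "s \<in> ?C" "t \<in> states N" "jump_rate lam mu P Q N s t > 0" for s t
        using that by (rule cl)
    qed
    then show ?thesis by (intro exI conjI)
  qed
  \<comment> \<open>\<open>d\<close> has total mass zero, so if it is nonzero it takes both
    signs.\<close>
  have balanced: "\<exists>s\<in>states N. c * d s > 0"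
    if "s\<^sub>0 \<in> states N" "d s\<^sub>0 \<noteq> 0" "c = 1 \<or> c = -1" for c :: real and s\<^sub>0
  proof (rule ccontr)
    assume neg: "\<not> (\<exists>s\<in>states N. c * d s > 0)"
    have "- c * d s \<ge> 0" if "s \<in> states N" for s
      using neg that by (simp add: not_less)
    moreover have "(\<Sum>s\<in>states N. - c * d s) = 0"
      using sum_d by (simp add: sum_negf sum_distrib_left[symmetric])
    ultimately have "\<forall>s\<in>states N. - c * d s = 0"
      using sum_nonneg_eq_0_iff[where f = "\<lambda>s. - c * d s", OF finite_states] by simp
    then have "- c * d s\<^sub>0 = 0" using that(1) by (rule bspec)
    then show False using that(2,3) by auto
  qed
  have "d s = 0" if s: "s \<in> states N" for s
  proof (rule ccontr)
    assume ne: "d s \<noteq> 0"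
    obtain a where "a \<in> states N" "1 * d a > 0" using balanced[OF s ne, of 1] by blast
    then obtain D where D: "D \<subseteq> {s\<in>states N. 1 * d s > 0}" "recurrent_class lam mu P Q N D"
      using half[of a 1] by blast
    obtain b where "b \<in> states N" "-1 * d b > 0" using balanced[OF s ne, of "-1"] by blast
    then obtain D' where D': "D' \<subseteq> {s\<in>states N. -1 * d s > 0}" "recurrent_class lam mu P Q N D'"
      using half[of b "-1"] by blast
    have "D = D'" using single D(2) D'(2) unfolding single_recurrent_class_def by blast
    moreover obtain u where "u \<in> D" using D(2) unfolding recurrent_class_def by blast
    ultimately have "1 * d u > 0" "-1 * d u > 0" using D(1) D'(1) by blast+
    then show False by simp
  qed
  moreover have "d s = 0" if "s \<notin> states N" for s
  proof -
    have "s \<notin> set_pmf p" "s \<notin> set_pmf q" using that supp by blast+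
    then show ?thesis by (simp add: d_def set_pmf_iff)
  qed
  ultimately show ?thesis by (intro pmf_eqI) (auto simp: d_def)
qed

section \<open>Rescaling the arrival rates\<close>

text \<open>Only pickups depend on \<open>lam\<close>; the remaining terms are unchanged and are
  absorbed by \<open>c \<ge> 1\<close>. The bound serves to compare which jumps are
  possible.\<close>

lemma jump_rate_le_scaled:
  assumes "\<And>i. 0 \<le> lam i" and "\<And>i. lam i \<le> c * lam' i" and c: "c \<ge> 1"
    and mu: "\<And>i j. mu i j \<ge> 0"
    and P: "row_stochastic P" and Q: "row_stochastic Q"
  shows "jump_rate lam mu P Q N s t \<le> c * jump_rate lam' mu P Q N s t"
proof -
  obtain E F where s: "s = (E, F)" by (cases s)
  have le: "a \<le> c * a" if "a \<ge> 0" for a :: real using that c by (simp add: mult_le_cancel_right1)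
  have PQ: "P i j \<ge> 0" "Q i j \<ge> 0" for i j using P Q by (auto simp: row_stochastic_def)
  have 1: "real N * lam i * P i j * of_bool b \<le> c * (real N * lam' i * P i j * of_bool b)" for i j b
    using mult_right_mono[OF assms(2)[of i], of "real N * P i j * of_bool b"] PQ
    by (simp add: mult_ac)
  show ?thesis
    unfolding s jump_rate_def prod.case distrib_left sum_distrib_left if_distrib[of "(*) c"] mult_zero_right
    by (intro add_mono sum_mono) (auto simp: 1 intro!: le mult_nonneg_nonneg mu PQ)
qed

text \<open>Recurrent classes depend only on which rates are positive, and scaling
  \<open>lam\<close> by a positive constant does not alter that.\<close>

lemma single_recurrent_class_scale:
  assumes lam: "\<And>i. lam i > 0" and mu: "\<And>i j. mu i j > 0"
    and P: "row_stochastic P" and Q: "row_stochastic Q" and \<kappa>: "\<kappa> > 0"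
  shows "single_recurrent_class (\<lambda>i. lam i / \<kappa>) mu P Q N \<longleftrightarrow> single_recurrent_class lam mu P Q N"
proof -
  have mu': "mu i j \<ge> 0" for i j using mu less_imp_le by blast
  have *: "lam i \<le> max 1 \<kappa> * (lam i / \<kappa>)" "lam i / \<kappa> \<le> max 1 (1 / \<kappa>) * lam i" for i
    using lam[of i] \<kappa> by (auto simp: field_simps max_def)
  have pos: "jump_rate (\<lambda>i. lam i / \<kappa>) mu P Q N s t > 0 \<longleftrightarrow> jump_rate lam mu P Q N s t > 0" for s t
  proof
    assume "jump_rate (\<lambda>i. lam i / \<kappa>) mu P Q N s t > 0"
    also have "\<dots> \<le> max 1 (1 / \<kappa>) * jump_rate lam mu P Q N s t"
      by (rule jump_rate_le_scaled) (use * mu' P Q lam \<kappa> in \<open>auto intro: less_imp_le\<close>)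
    finally show "jump_rate lam mu P Q N s t > 0" by (simp add: zero_less_mult_iff)
  next
    assume "jump_rate lam mu P Q N s t > 0"
    also have "\<dots> \<le> max 1 \<kappa> * jump_rate (\<lambda>i. lam i / \<kappa>) mu P Q N s t"
      by (rule jump_rate_le_scaled) (use * mu' P Q lam \<kappa> in \<open>auto intro: less_imp_le\<close>)
    finally show "jump_rate (\<lambda>i. lam i / \<kappa>) mu P Q N s t > 0" by (simp add: zero_less_mult_iff)
  qed
  show ?thesis
    unfolding single_recurrent_class_def recurrent_class_def accessible_def pos ..
qed

section \<open>Generating functions and asymptotics\<close>

text \<open>The known coefficient formula for products runs over multisets of size \<open>n\<close>;
  \<open>count\<close> identifies these with configurations.\<close>

lemma fps_prod_nth_confs:
  fixes F :: "'a::finite \<Rightarrow> real fps"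
  shows "fps_nth (\<Prod>a\<in>UNIV. F a) n = (\<Sum>m\<in>confs n. \<Prod>a\<in>UNIV. fps_nth (F a) (m a))"
proof -
  have size: "size X = (\<Sum>a\<in>UNIV. count X a)" for X :: "'a multiset"
    unfolding size_multiset_overloaded_eq by (rule sum.mono_neutral_left) (auto simp: not_in_iff)
  have "(\<Sum>X\<in>multisets_of_size UNIV n. \<Prod>a\<in>UNIV. fps_nth (F a) (count X a)) =
      (\<Sum>m\<in>confs n. \<Prod>a\<in>UNIV. fps_nth (F a) (m a))"
    by (rule sum.reindex_bij_witness[where i = Abs_multiset and j = count])
      (auto simp: multisets_of_size_def confs_def size count_Abs_multiset count_inverse)
  then show ?thesis by (simp add: fps_prod_nth')
qed

text \<open>The series \<open>1 / (1 - X)\<close>, generating function of a single-server queue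
  whose throughput equals its service rate.\<close>

abbreviation geo :: "real fps" where
  "geo \<equiv> Abs_fps (\<lambda>_. 1)"

lemma prod_fps_exp: "finite A \<Longrightarrow> (\<Prod>a\<in>A. fps_exp (c a :: real)) = fps_exp (sum c A)"
  by (induction A rule: finite_induct) (auto simp: fps_exp_add_mult)

text \<open>The weights factor over stations, so their sums are coefficients of a product of series.
  The saturated queues in \<open>A\<close> contribute \<open>geo\<close>; an infinite-server station
  contributes the exponential series of its mean load.\<close>

lemma sum_weight_confs:
  fixes y :: "'a::finite \<Rightarrow> real"
  assumes single: "\<And>a l. a \<in> A \<Longrightarrow> \<phi> a (Suc l) = y a" and "\<And>a. a \<in> A \<Longrightarrow> y a \<noteq> 0"
    and infinite: "\<And>a l. a \<notin> A \<Longrightarrow> \<phi> a (Suc l) = \<nu> a * real (Suc l)"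
  shows "(\<Sum>m\<in>confs n. weight y \<phi> m) = fps_nth (geo ^ card A * fps_exp (\<Sum>a\<in>-A. y a / \<nu> a)) n"
proof -
  define F where "F a = Abs_fps (\<lambda>k. \<Prod>l<k. y a / \<phi> a (Suc l))" for a
  have F1: "F a = geo" if "a \<in> A" for a
    using that assms(1,2) by (simp add: F_def)
  have F2: "F a = fps_exp (y a / \<nu> a)" if "a \<in> - A" for a
  proof (rule fps_ext)
    fix k
    have "(\<Prod>l<k. y a / (\<nu> a * real (Suc l))) = (y a / \<nu> a) ^ k / fact k"
      by (induction k) (auto simp: field_simps)
    then show "fps_nth (F a) k = fps_nth (fps_exp (y a / \<nu> a)) k"
      using that by (simp add: F_def infinite)
  qed
  have "(\<Sum>m\<in>confs n. weight y \<phi> m) = fps_nth (\<Prod>a\<in>UNIV. F a) n"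
    unfolding fps_prod_nth_confs by (simp add: weight_def F_def)
  also have "(\<Prod>a\<in>UNIV. F a) = (\<Prod>a\<in>A. F a) * (\<Prod>a\<in>-A. F a)"
    using prod.union_disjoint[of A "-A" F] by simp
  also have "(\<Prod>a\<in>A. F a) = geo ^ card A" using F1 by simp
  also have "(\<Prod>a\<in>-A. F a) = fps_exp (\<Sum>a\<in>-A. y a / \<nu> a)"
    using F2 by (simp add: prod_fps_exp)
  finally show ?thesis .
qed

lemma geo_power_nth: "fps_nth (geo ^ Suc r) n = real ((r + n) choose n)"
proof (induction r arbitrary: n)
  case (Suc r)
  have "fps_nth (geo ^ Suc (Suc r)) n = (\<Sum>i\<le>n. fps_nth (geo ^ Suc r) i)"
    unfolding power_Suc2[of geo "Suc r"] fps_mult_nth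
    by (simp add: atLeast0AtMost)
  also have "\<dots> = real (Suc r + n choose n)"
    unfolding Suc.IH using arg_cong[OF sum_choose_lower[of r n], of real] by simp
  finally show ?case .
qed simp

text \<open>For \<open>r \<ge> 1\<close> the quotient of the two binomial coefficients is
  \<open>r / (r + k)\<close>. The factor \<open>r + 1\<close> instead of \<open>r\<close> keeps the
  case \<open>r = 0\<close>, \<open>k = 0\<close> true.\<close>

lemma geo_power_nth_bound:
  "fps_nth (geo ^ r) k \<le> real (r + 1) / real (k + 1) * fps_nth (geo ^ Suc r) k"
proof (cases r)
  case 0
  then show ?thesis by simp
next
  case (Suc q)
  have "real (Suc q) * real (Suc q + k choose k) = real (Suc q + k) * real (q + k choose k)"
    using binomial_absorb_comp[of "Suc q + k" k] by (metis (no_types, lifting) Suc_eq_plus1 add_Suc add_diff_cancel_right' diff_Suc_1 of_nat_mult)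
  moreover have "real (k + 1) * real (q + k choose k) \<le> real (Suc q + k) * real (q + k choose k)"
    by (intro mult_right_mono) auto
  ultimately have "real (k + 1) * real (q + k choose k) \<le> real (Suc q) * real (Suc q + k choose k)"
    by simp
  also have "\<dots> \<le> real (r + 1) * real (Suc q + k choose k)"
    by (intro mult_right_mono) (auto simp: Suc)
  finally show ?thesis
    unfolding Suc geo_power_nth by (simp add: field_simps)
qed

text \<open>For \<open>k < L\<close> each of the \<open>L^2\<close> weights from \<open>w k\<close>
  on is at least \<open>w k / 2\<close>, so \<open>w k\<close> is at most \<open>2 / L^2\<close> of
  the total. The indices below \<open>L\<close> thus contribute at most \<open>2 / L\<close> of it,
  and those from \<open>L\<close> on at most \<open>1 / L\<close> because of the divisor.\<close>

lemma slowly_decaying_weights: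
  fixes w :: "nat \<Rightarrow> real"
  assumes w: "\<And>k. w k \<ge> 0" and step: "\<And>k. k < N \<Longrightarrow> (1 - real k / real N) * w k \<le> w (Suc k)"
    and L: "L \<ge> 1" and N: "N \<ge> 4 * L ^ 4"
  shows "(\<Sum>k\<le>N. w k / real (k + 1)) \<le> 3 / real L * (\<Sum>k\<le>N. w k)"
proof -
  define W where "W = (\<Sum>k\<le>N. w k)"
  \<comment> \<open>Bounds all indices \<open>k + j\<close> that occur below;
    \<open>N \<ge> 4 * L ^ 4\<close> is what makes \<open>L^2\<close> steps, each losing at most a
    fraction \<open>K / N\<close>, cost at most one half.\<close>
  define K where "K = L + L^2"
  have L2: "L \<le> L^2" using L by (simp add: power2_eq_square)
  have L24: "L^2 \<le> L^4" using L by (intro power_increasing) auto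
  have Npos: "N > 0" using N L by (metis gr_zeroI mult_is_0 not_one_le_zero power_not_zero le_zero_eq zero_neq_numeral)
  have K: "2 * (L^2 * K) \<le> N"
  proof -
    have "L^2 * K \<le> L^2 * (2 * L^2)" using L2 by (intro mult_left_mono) (auto simp: K_def)
    also have "\<dots> = 2 * L^4" by (simp add: power_add[symmetric])
    finally show ?thesis using N by linarith
  qed
  have KN: "K \<le> N"
  proof -
    have "K \<le> L^2 * K" using L by simp
    then show ?thesis using K by linarith
  qed
  have small: "w k \<le> 2 / real (L^2) * W" if "k < L" for k
  proof -
    \<comment> \<open>Bernoulli's inequality for the power \<open>(1 - K / N) ^ j\<close>, carried
      along in the induction.\<close>
    have grow: "(1 - real j * real K / real N) * w k \<le> w (k + j)" if "j \<le> L^2" for j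
      using that
    proof (induction j)
      case (Suc j)
      have kj: "k + j < K" using Suc.prems \<open>k < L\<close> by (simp add: K_def)
      have a: "1 - real K / real N \<ge> 0" using KN Npos by simp
      have "(1 - real (Suc j) * real K / real N) * w k
          \<le> ((1 - real K / real N) * (1 - real j * real K / real N)) * w k"
        by (intro mult_right_mono w) (use Npos in \<open>simp add: field_simps\<close>)
      also have "\<dots> \<le> (1 - real K / real N) * w (k + j)"
        unfolding mult.assoc using Suc a by (intro mult_left_mono) auto
      also have "\<dots> \<le> (1 - real (k + j) / real N) * w (k + j)"
        using kj by (intro mult_right_mono w) (auto intro!: divide_right_mono)
      also have "\<dots> \<le> w (k + Suc j)" using step[of "k + j"] kj KN by simp
      finally show ?case .
    qed simp
    have half: "w k / 2 \<le> w (k + j)" if "j < L^2" for j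
    proof -
      have "2 * (j * K) \<le> N"
        using K that by (meson le_trans less_imp_le mult_le_mono1 mult_le_mono2)
      then have "real (2 * (j * K)) \<le> real N" by (rule of_nat_mono)
      then have "1 / 2 \<le> 1 - real j * real K / real N" using Npos by (simp add: field_simps)
      then have "1 / 2 * w k \<le> (1 - real j * real K / real N) * w k" by (intro mult_right_mono w)
      also have "\<dots> \<le> w (k + j)" using that by (intro grow) simp
      finally show ?thesis by simp
    qed
    have "real (L^2) * (w k / 2) = (\<Sum>j<L^2. w k / 2)" by simp
    also have "\<dots> \<le> (\<Sum>j<L^2. w (k + j))" by (intro sum_mono half) simp
    also have "\<dots> = (\<Sum>i\<in>(+) k ` {..<L^2}. w i)" by (subst sum.reindex) auto
    also have "\<dots> \<le> W"
      unfolding W_def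
    proof (rule sum_mono2)
      show "(+) k ` {..<L^2} \<subseteq> {..N}" using \<open>k < L\<close> KN by (auto simp: K_def)
    qed (auto simp: w)
    finally show ?thesis using L by (simp add: field_simps)
  qed
  have W0: "W \<ge> 0" unfolding W_def by (intro sum_nonneg w)
  have LN: "L \<le> N" using KN by (simp add: K_def)
  have "(\<Sum>k\<le>N. w k / real (k + 1)) = (\<Sum>k<L. w k / real (k + 1)) + (\<Sum>k=L..N. w k / real (k + 1))"
    using LN by (subst sum.union_disjoint[symmetric]) (auto intro!: sum.cong)
  also have "(\<Sum>k<L. w k / real (k + 1)) \<le> (\<Sum>k<L. 2 / real (L^2) * W)"
  proof (rule sum_mono)
    fix k assume "k \<in> {..<L}"
    then have "w k \<le> 2 / real (L^2) * W" by (intro small) simp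
    moreover have "w k / real (k + 1) \<le> w k" using w[of k] by (simp add: field_simps)
    ultimately show "w k / real (k + 1) \<le> 2 / real (L^2) * W" by linarith
  qed
  also have "(\<Sum>k<L. 2 / real (L^2) * W) = 2 / real L * W"
    using L by (simp add: power2_eq_square)
  also have "(\<Sum>k=L..N. w k / real (k + 1)) \<le> (\<Sum>k=L..N. w k / real L)"
    using L by (intro sum_mono divide_left_mono w) auto
  also have "\<dots> = 1 / real L * (\<Sum>k=L..N. w k)" by (simp add: sum_divide_distrib)
  also have "\<dots> \<le> 1 / real L * W"
    unfolding W_def by (intro mult_left_mono sum_mono2) (auto simp: w)
  finally show ?thesis unfolding W_def[symmetric] by (simp add: field_simps add_divide_distrib)
qed

text \<open>Dropping one factor \<open>geo\<close> costs about \<open>1 / (k + 1)\<close> in the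
  term with \<open>k\<close> available cars, and by slow decay small \<open>k\<close> carry little
  of the total. Here \<open>\<rho> \<le> 1\<close> enters: it gives the step inequality for the
  exponential coefficients.\<close>

lemma geo_exp_ratio_bound:
  assumes \<rho>: "0 \<le> \<rho>" "\<rho> \<le> 1" and L: "L \<ge> 1" and N: "N \<ge> 4 * L ^ 4"
  shows "fps_nth (geo ^ r * fps_exp (real N * \<rho>)) N
     \<le> 3 * real (r + 1) / real L * fps_nth (geo ^ Suc r * fps_exp (real N * \<rho>)) N"
proof -
  define p where "p m = (real N * \<rho>) ^ m / fact m" for m
  define c where "c k = fps_nth (geo ^ Suc r) k" for k
  \<comment> \<open>The joint weight of \<open>k\<close> available cars, spread over
    \<open>Suc r\<close> regions, and \<open>N - k\<close> travelling ones.\<close>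
  define w where "w k = c k * p (N - k)" for k
  have p: "p m \<ge> 0" for m using \<rho> by (simp add: p_def)
  have c: "c k \<ge> 0" "c k \<le> c (Suc k)" for k
    unfolding c_def geo_power_nth by simp_all
  have p_step: "real (Suc m) / real N * p (Suc m) \<le> p m" for m
  proof (cases "N = 0")
    case False
    have "real (Suc m) / real N * p (Suc m) = \<rho> * p m"
      using False by (simp add: p_def field_simps del: of_nat_Suc)
    then show ?thesis using \<rho> p[of m] by (simp add: mult_left_le_one_le)
  qed (use p in simp)
  have step: "(1 - real k / real N) * w k \<le> w (Suc k)" if "k < N" for k
  proof -
    obtain m where m: "N = k + Suc m" using \<open>k < N\<close> less_iff_Suc_add by auto
    have "(1 - real k / real N) * w k = c k * (real (Suc m) / real N * p (Suc m))"
      using that unfolding w_def by (simp add: m field_simps)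
    also have "\<dots> \<le> c k * p m" by (intro mult_left_mono p_step c)
    also have "\<dots> \<le> c (Suc k) * p m" by (intro mult_right_mono c p)
    finally show ?thesis by (simp add: w_def m)
  qed
  have "fps_nth (geo ^ r * fps_exp (real N * \<rho>)) N = (\<Sum>k\<le>N. fps_nth (geo ^ r) k * p (N - k))"
    by (simp add: fps_mult_nth p_def atLeast0AtMost)
  also have "\<dots> \<le> (\<Sum>k\<le>N. real (r + 1) * (w k / real (k + 1)))"
  proof (rule sum_mono)
    fix k
    show "fps_nth (geo ^ r) k * p (N - k) \<le> real (r + 1) * (w k / real (k + 1))"
      using mult_right_mono[OF geo_power_nth_bound[of r k] p[of "N - k"]]
      by (simp add: w_def c_def)
  qed
  also have "\<dots> = real (r + 1) * (\<Sum>k\<le>N. w k / real (k + 1))" by (simp add: sum_distrib_left)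
  also have "\<dots> \<le> real (r + 1) * (3 / real L * (\<Sum>k\<le>N. w k))"
    by (intro mult_left_mono slowly_decaying_weights[OF _ step L N]) (auto simp: w_def c p)
  also have "(\<Sum>k\<le>N. w k) = fps_nth (geo ^ Suc r * fps_exp (real N * \<rho>)) N"
    by (simp add: fps_mult_nth p_def w_def c_def atLeast0AtMost del: power_Suc)
  also have "real (r + 1) * (3 / real L * Y) = 3 * real (r + 1) / real L * Y" for Y
    by simp
  finally show ?thesis .
qed

lemma geo_exp_pos:
  assumes "\<rho> \<ge> 0"
  shows "fps_nth (geo ^ Suc r * fps_exp \<rho>) n > 0"
proof -
  have "0 < fps_nth (geo ^ Suc r) n * fps_nth (fps_exp \<rho>) (n - n)"
    unfolding geo_power_nth by simp
  also have "\<dots> \<le> (\<Sum>k=0..n. fps_nth (geo ^ Suc r) k * fps_nth (fps_exp \<rho>) (n - k))"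
    using assms unfolding geo_power_nth by (intro member_le_sum) auto
  finally show ?thesis by (simp add: fps_mult_nth del: power_Suc)
qed

text \<open>Multiplication by \<open>1 - X\<close> takes differences of consecutive coefficients and
  cancels one factor \<open>geo\<close>.\<close>

lemma geo_exp_diff:
  "fps_nth (geo ^ Suc r * E) (Suc M) - fps_nth (geo ^ Suc r * E) M = fps_nth (geo ^ r * E) (Suc M)"
proof -
  have "(1 - fps_X) * geo = 1"
    using fps_inverse_gp'[where 'a = real] by (metis fps_nth_Abs_fps inverse_mult_eq_1 one_neq_zero)
  then have "(1 - fps_X) * (geo ^ Suc r * E) = geo ^ r * E"
    by (simp add: mult.assoc[symmetric])
  then have "fps_nth (geo ^ r * E) (Suc M) = fps_nth ((1 - fps_X) * (geo ^ Suc r * E)) (Suc M)"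
    by (simp only:)
  also have "\<dots> = fps_nth (geo ^ Suc r * E) (Suc M) - fps_nth (geo ^ Suc r * E) M"
    by (simp add: left_diff_distrib del: power_Suc)
  finally show ?thesis by simp
qed

text \<open>The quotient falls short of \<open>1\<close> by exactly the ratio bounded in
  \<open>geo_exp_ratio_bound\<close>. Both coefficients belong to the same series, with
  \<open>Suc M\<close> cars fixing the rates.\<close>

lemma geo_exp_ratio_tendsto:
  assumes \<rho>: "0 \<le> \<rho>" "\<rho> \<le> 1"
  shows "(\<lambda>M. fps_nth (geo ^ Suc r * fps_exp (real (Suc M) * \<rho>)) M /
              fps_nth (geo ^ Suc r * fps_exp (real (Suc M) * \<rho>)) (Suc M)) \<longlonglongrightarrow> 1"
proof -
  define B where "B s M n = fps_nth (geo ^ s * fps_exp (real (Suc M) * \<rho>)) n" for s M n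
  have pos: "B (Suc r) M n > 0" for M n
    unfolding B_def using \<rho> by (intro geo_exp_pos) simp
  have nonneg: "B r M n \<ge> 0" for M n
  proof (cases r)
    case 0
    then show ?thesis using \<rho> by (simp add: B_def)
  next
    case (Suc q)
    then show ?thesis unfolding B_def Suc using \<rho> by (intro less_imp_le[OF geo_exp_pos]) simp
  qed
  have ratio: "B (Suc r) M M / B (Suc r) M (Suc M) = 1 - B r M (Suc M) / B (Suc r) M (Suc M)" for M
    using geo_exp_diff[of r "fps_exp (real (Suc M) * \<rho>)" M] pos[of M "Suc M"]
    by (simp add: B_def field_simps del: power_Suc)
  have "(\<lambda>M. B r M (Suc M) / B (Suc r) M (Suc M)) \<longlonglongrightarrow> 0"
  proof (rule LIMSEQ_I)
    fix \<epsilon> :: real assume "\<epsilon> > 0"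
    \<comment> \<open>Large enough that the bound \<open>3 * (r + 1) / L\<close> drops below
      \<open>\<epsilon>\<close>.\<close>
    define L where "L = nat \<lceil>3 * real (r + 1) / \<epsilon>\<rceil> + 1"
    have L: "L \<ge> 1" "3 * real (r + 1) / real L < \<epsilon>"
    proof -
      have "3 * real (r + 1) / \<epsilon> < real L" unfolding L_def by linarith
      moreover have "real L > 0" by (simp add: L_def)
      ultimately show "3 * real (r + 1) / real L < \<epsilon>"
        using \<open>\<epsilon> > 0\<close> by (simp add: divide_less_eq mult.commute)
    qed (simp add: L_def)
    show "\<exists>no. \<forall>M\<ge>no. norm (B r M (Suc M) / B (Suc r) M (Suc M) - 0) < \<epsilon>"
    proof (intro exI allI impI)
      fix M assume "M \<ge> 4 * L ^ 4"
      then have "B r M (Suc M) \<le> 3 * real (r + 1) / real L * B (Suc r) M (Suc M)"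
        unfolding B_def by (intro geo_exp_ratio_bound \<rho> L) simp
      also have "\<dots> < \<epsilon> * B (Suc r) M (Suc M)" using L(2) pos by (intro mult_strict_right_mono)
      finally show "norm (B r M (Suc M) / B (Suc r) M (Suc M) - 0) < \<epsilon>"
        using pos[of M "Suc M"] nonneg[of M "Suc M"] by (simp add: divide_less_eq)
    qed
  qed
  then have "(\<lambda>M. 1 - B r M (Suc M) / B (Suc r) M (Suc M)) \<longlonglongrightarrow> 1 - 0"
    by (intro tendsto_intros)
  then show ?thesis unfolding ratio[symmetric] by (simp add: B_def)
qed

section \<open>The linear program\<close>

text \<open>Brouwer's fixed point theorem for \<open>v \<mapsto> v K\<close> on the probability
  simplex. Applied to the product of \<open>P\<close> and \<open>Q\<close>, it solves the traffic
  equations.\<close>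

lemma stochastic_matrix_invariant:
  fixes K :: "'r::finite \<Rightarrow> 'r \<Rightarrow> real"
  assumes "row_stochastic K"
  obtains x where "\<And>i. x i \<ge> 0" and "(\<Sum>i\<in>UNIV. x i) = 1" and "\<And>i. x i = (\<Sum>j\<in>UNIV. x j * K j i)"
proof -
  have K: "K i j \<ge> 0" "(\<Sum>j\<in>UNIV. K i j) = 1" for i j
    using assms by (auto simp: row_stochastic_def)
  define S where "S = {v :: real^'r. (\<forall>i. 0 \<le> v $ i) \<and> (\<Sum>i\<in>UNIV. v $ i) = 1}"
  define T where "T v = (\<chi> i. \<Sum>j\<in>UNIV. v $ j * K j i)" for v :: "real^'r"
  have closed: "closed S"
    unfolding S_def
    by (intro closed_Collect_conj closed_Collect_all closed_Collect_le closed_Collect_eq continuous_intros)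
  have "v $ i \<le> 1" if "v \<in> S" for v i
    using that member_le_sum[of i UNIV "\<lambda>i. v $ i"] by (simp add: S_def)
  then have "S \<subseteq> cbox 0 1" by (auto simp: S_def mem_box_cart)
  then have "compact S"
    using compact_Int_closed[OF compact_cbox closed, of 0 1] by (simp add: Int_absorb1)
  moreover have "convex S"
    by (rule convexI)
      (auto simp: S_def sum.distrib sum_distrib_left[symmetric] intro!: add_nonneg_nonneg mult_nonneg_nonneg)
  moreover have "S \<noteq> {}"
  proof -
    \<comment> \<open>The point mass at an arbitrary region.\<close>
    have "(\<chi> i. if i = undefined then 1 else 0) \<in> S" by (simp add: S_def)
    then show ?thesis by blast
  qed
  moreover have "continuous_on S T"
    unfolding T_def by (intro continuous_intros)
  moreover have "T \<in> S \<rightarrow> S"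
  proof
    fix v assume v: "v \<in> S"
    have "(\<Sum>i\<in>UNIV. \<Sum>j\<in>UNIV. v $ j * K j i) = (\<Sum>j\<in>UNIV. \<Sum>i\<in>UNIV. v $ j * K j i)"
      by (rule sum.swap)
    also have "\<dots> = 1" using v by (simp add: sum_distrib_left[symmetric] K S_def)
    finally show "T v \<in> S"
      using v K by (auto simp: S_def T_def intro!: sum_nonneg mult_nonneg_nonneg)
  qed
  ultimately obtain v where v: "v \<in> S" "T v = v" using brouwer by metis
  show thesis
  proof (rule that[of "\<lambda>i. v $ i"])
    show "v $ i = (\<Sum>j\<in>UNIV. v $ j * K j i)" for i
      using arg_cong[OF v(2), of "\<lambda>v. v $ i"] by (simp add: T_def)
  qed (use v in \<open>auto simp: S_def\<close>)
qed

text \<open>The mean number of cars in transit when cars leave region \<open>i\<close> with passengers at rate \<open>x i\<close>.\<close>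

definition travel_load ::
  "('r::finite \<Rightarrow> 'r \<Rightarrow> real) \<Rightarrow> ('r \<Rightarrow> 'r \<Rightarrow> real) \<Rightarrow> ('r \<Rightarrow> 'r \<Rightarrow> real) \<Rightarrow> ('r \<Rightarrow> real) \<Rightarrow> real" where
  "travel_load mu P Q x = (\<Sum>i\<in>UNIV. \<Sum>j\<in>UNIV. x i * P i j / mu i j)
     + (\<Sum>i\<in>UNIV. \<Sum>j\<in>UNIV - {i}. (\<Sum>k\<in>UNIV. x k * P k i) * Q i j / mu i j)"

text \<open>The traffic equations \<open>x = x P Q\<close>; the bracketed sum is the rate of
  drop-offs at \<open>j\<close>.\<close>

definition balanced_flow ::
  "('r::finite \<Rightarrow> 'r \<Rightarrow> real) \<Rightarrow> ('r \<Rightarrow> 'r \<Rightarrow> real) \<Rightarrow> ('r \<Rightarrow> real) \<Rightarrow> bool" where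
  "balanced_flow P Q x \<longleftrightarrow> (\<forall>i. x i = (\<Sum>j\<in>UNIV. (\<Sum>k\<in>UNIV. x k * P k j) * Q j i))"

lemma balanced_flow_scale:
  assumes "balanced_flow P Q x" shows "balanced_flow P Q (\<lambda>i. c * x i)"
  unfolding balanced_flow_def
proof
  fix i
  have "x i = (\<Sum>j\<in>UNIV. (\<Sum>k\<in>UNIV. x k * P k j) * Q j i)"
    using assms unfolding balanced_flow_def by blast
  then have "c * x i = c * (\<Sum>j\<in>UNIV. (\<Sum>k\<in>UNIV. x k * P k j) * Q j i)" by (rule arg_cong)
  then show "c * x i = (\<Sum>j\<in>UNIV. (\<Sum>k\<in>UNIV. c * x k * P k j) * Q j i)"
    by (simp only: sum_distrib_left sum_distrib_right mult.assoc)
qed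

lemma travel_load_scale: "travel_load mu P Q (\<lambda>i. c * x i) = c * travel_load mu P Q x"
proof -
  define a where "a i = (\<Sum>k\<in>UNIV. x k * P k i)" for i
  have a: "(\<Sum>k\<in>UNIV. c * x k * P k i) = c * a i" for i
    by (simp only: a_def sum_distrib_left mult.assoc)
  show ?thesis
    unfolding travel_load_def a a_def[symmetric]
    by (simp only: distrib_left sum_distrib_left mult.assoc times_divide_eq_right)
qed

section \<open>The linear program as minimisation of \<open>travel_load\<close> over balanced
  policies\<close>

text \<open>The first two families of constraints eliminate \<open>f\<close> and the off-diagonal
  part of \<open>e\<close>; the third then becomes the traffic equation for \<open>lam\<close>
  itself.\<close>

lemma lp_feasible_flow:
  assumes "lp_feasible lam mu P q f e" and mu: "\<And>i j. mu i j > 0"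
  shows "row_stochastic q" "balanced_flow P q lam" "lp_objective f e = travel_load mu P q lam"
proof -
  note feasible = assms(1)[unfolded lp_feasible_def]
  note f0 = feasible[THEN conjunct1]
  note e0 = feasible[THEN conjunct2, THEN conjunct1]
  note b0 = feasible[THEN conjunct2, THEN conjunct2, THEN conjunct1]
  note q = feasible[THEN conjunct2, THEN conjunct2, THEN conjunct2]
  show "row_stochastic q" unfolding row_stochastic_def by (rule q)
  have f: "mu i j * f i j = lam i * P i j" for i j by (rule f0[rule_format, symmetric])
  have e: "mu i j * e i j = q i j * (\<Sum>k\<in>UNIV. lam k * P k i)" if "j \<noteq> i" for i j
    using e0[rule_format, OF that] unfolding f .
  have "lam i = (\<Sum>j\<in>UNIV. (\<Sum>k\<in>UNIV. lam k * P k j) * q j i)" for i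
  proof -
    have "lam i = (\<Sum>k\<in>UNIV - {i}. mu k i * e k i) + q i i * (\<Sum>k\<in>UNIV. mu k i * f k i)"
      by (rule b0[rule_format])
    also have "(\<Sum>k\<in>UNIV - {i}. mu k i * e k i) = (\<Sum>j\<in>UNIV - {i}. (\<Sum>k\<in>UNIV. lam k * P k j) * q j i)"
      by (rule sum.cong) (simp_all add: e mult.commute[of "q _ _"])
    also have "\<dots> + q i i * (\<Sum>k\<in>UNIV. mu k i * f k i) =
        (\<Sum>j\<in>UNIV. (\<Sum>k\<in>UNIV. lam k * P k j) * q j i)"
      unfolding f
      using sum.remove[of UNIV i "\<lambda>j. (\<Sum>k\<in>UNIV. lam k * P k j) * q j i"]
      by (simp add: mult.commute)
    finally show ?thesis .
  qed
  then show "balanced_flow P q lam" unfolding balanced_flow_def by blast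
  have f': "f i j = lam i * P i j / mu i j" for i j
    using f[of i j] mu[of i j] by (simp add: field_simps)
  have e': "e i j = (\<Sum>k\<in>UNIV. lam k * P k i) * q i j / mu i j" if "j \<in> UNIV - {i}" for i j
    using e[of j i] that mu[of i j] by (simp add: field_simps)
  show "lp_objective f e = travel_load mu P q lam"
    unfolding lp_objective_def travel_load_def f'
    by (intro arg_cong2[of _ _ _ _ "(+)"] sum.cong refl e')
qed

lemma lp_feasible_exists:
  assumes mu: "\<And>i j. mu i j > 0" and Q: "row_stochastic q" and flow: "balanced_flow P q lam"
  shows "\<exists>f e. lp_feasible lam mu P q f e"
proof (intro exI)
  have mu': "mu i j \<noteq> 0" for i j using mu[of i j] by simp
  show "lp_feasible lam mu P q (\<lambda>i j. lam i * P i j / mu i j)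
      (\<lambda>i j. (\<Sum>k\<in>UNIV. lam k * P k i) * q i j / mu i j)"
    unfolding lp_feasible_def
  proof (intro conjI allI impI)
    fix i
    have "lam i = (\<Sum>j\<in>UNIV. (\<Sum>k\<in>UNIV. lam k * P k j) * q j i)"
      using flow unfolding balanced_flow_def by blast
    also have "\<dots> = (\<Sum>k\<in>UNIV. lam k * P k i) * q i i +
        (\<Sum>j\<in>UNIV - {i}. (\<Sum>k\<in>UNIV. lam k * P k j) * q j i)"
      by (rule sum.remove) auto
    finally show "lam i = (\<Sum>k\<in>UNIV - {i}. mu k i * ((\<Sum>k'\<in>UNIV. lam k' * P k' k) * q k i / mu k i)) +
        q i i * (\<Sum>k\<in>UNIV. mu k i * (lam k * P k i / mu k i))"
      by (simp add: mu' mult.commute)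
  qed (use Q mu' in \<open>auto simp: row_stochastic_def mult.commute\<close>)
qed

text \<open>Choosing each next region with probability proportional to \<open>lam\<close> restores
  the flow \<open>lam\<close>, as \<open>P\<close> preserves the total rate. This makes the feasible
  region non-empty.\<close>

lemma proportional_policy:
  assumes lam: "\<And>i. lam i > 0" and P: "row_stochastic P"
  defines "q \<equiv> \<lambda>_ j. lam j / (\<Sum>k\<in>UNIV. lam k)"
  shows "row_stochastic q" "balanced_flow P q lam"
proof -
  have pos: "(\<Sum>k\<in>UNIV. lam k) > 0" using lam by (intro sum_pos) auto
  show "row_stochastic q"
    unfolding row_stochastic_def q_def using pos lam
    by (auto simp: sum_divide_distrib[symmetric] less_imp_le)
  have "(\<Sum>j\<in>UNIV. \<Sum>k\<in>UNIV. lam k * P k j) = (\<Sum>k\<in>UNIV. \<Sum>j\<in>UNIV. lam k * P k j)"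
    by (rule sum.swap)
  also have "\<dots> = (\<Sum>k\<in>UNIV. lam k)"
    using P by (simp add: sum_distrib_left[symmetric] row_stochastic_def)
  finally show "balanced_flow P q lam"
    unfolding balanced_flow_def q_def sum_distrib_right[symmetric] using pos by simp
qed

text \<open>The balanced policies form a compact set, on which the load is continuous.\<close>

lemma travel_load_minimum:
  fixes lam :: "'r::finite \<Rightarrow> real"
  assumes lam: "\<And>i. lam i > 0" and P: "row_stochastic P"
  obtains q where "row_stochastic q" "balanced_flow P q lam"
    and "\<And>q'. row_stochastic q' \<Longrightarrow> balanced_flow P q' lam \<Longrightarrow> travel_load mu P q lam \<le> travel_load mu P q' lam"
proof -
  \<comment> \<open>Matrices are encoded as vectors indexed by pairs to inherit the topology of
    Euclidean space.\<close>
  define mat where "mat v i j = v $ (i, j)" for v :: "real^('r \<times> 'r)" and i j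
  define S where "S = {v. row_stochastic (mat v) \<and> balanced_flow P (mat v) lam}"
  have closed: "closed S"
    unfolding S_def row_stochastic_def balanced_flow_def mat_def
    by (intro closed_Collect_conj closed_Collect_all closed_Collect_le closed_Collect_eq continuous_intros)
  have "S \<subseteq> cbox 0 1"
  proof
    fix v assume "v \<in> S"
    then have v: "mat v i j \<ge> 0" "(\<Sum>j\<in>UNIV. mat v i j) = 1" for i j
      by (auto simp: S_def row_stochastic_def)
    have "mat v i j \<le> 1" for i j
      using member_le_sum[of j UNIV "mat v i"] v by simp
    with v(1) show "v \<in> cbox 0 1" by (auto simp: mem_box_cart mat_def)
  qed
  then have "compact S"
    using compact_Int_closed[OF compact_cbox closed, of 0 1] by (simp add: Int_absorb1)
  moreover have surj: "\<exists>v. v \<in> S \<and> mat v = q" if "row_stochastic q" "balanced_flow P q lam" for q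
  proof -
    have "mat (\<chi> a. q (fst a) (snd a)) = q" by (simp add: mat_def fun_eq_iff)
    with that have "(\<chi> a. q (fst a) (snd a)) \<in> S" by (simp only: S_def mem_Collect_eq)
    with \<open>mat (\<chi> a. q (fst a) (snd a)) = q\<close> show ?thesis by (intro exI conjI)
  qed
  moreover have "S \<noteq> {}"
    using surj[OF proportional_policy[OF lam P]] by auto
  moreover have "continuous_on S (\<lambda>v. travel_load mu P (mat v) lam)"
    unfolding travel_load_def mat_def divide_inverse
    by (intro continuous_on_add continuous_on_sum continuous_on_mult_right continuous_on_mult_left
        continuous_on_component continuous_on_const continuous_on_id)
  ultimately obtain v where v: "v \<in> S"
      "\<And>u. u \<in> S \<Longrightarrow> travel_load mu P (mat v) lam \<le> travel_load mu P (mat u) lam"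
    using continuous_attains_inf[of S "\<lambda>v. travel_load mu P (mat v) lam"] by blast
  show thesis
  proof (rule that)
    show "travel_load mu P (mat v) lam \<le> travel_load mu P q' lam"
      if "row_stochastic q'" "balanced_flow P q' lam" for q'
      using surj[OF that] v(2) by blast
  qed (use v(1) in \<open>simp_all add: S_def\<close>)
qed

lemma travel_load_pos:
  assumes lam: "\<And>i. lam i > 0" and mu: "\<And>i j. mu i j > 0"
    and P: "row_stochastic P" and Q: "row_stochastic Q"
  shows "travel_load mu P Q lam > 0"
proof -
  have PQ: "P i j \<ge> 0" "Q i j \<ge> 0" for i j using P Q by (auto simp: row_stochastic_def)
  have nonneg: "lam i * P i j / mu i j \<ge> 0" for i j
    using lam[of i] mu[of i j] PQ by simp
  have "\<exists>i j. P i j \<noteq> 0"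
  proof (rule ccontr)
    assume "\<nexists>i j. P i j \<noteq> 0"
    then have "(\<Sum>j\<in>UNIV. P undefined j) = 0" by simp
    then show False using P by (simp add: row_stochastic_def)
  qed
  then obtain i j where "P i j > 0" using PQ(1) by (metis order_le_less)
  then have "0 < lam i * P i j / mu i j" using lam mu by simp
  also have "\<dots> \<le> (\<Sum>j\<in>UNIV. lam i * P i j / mu i j)"
    using nonneg by (intro member_le_sum) auto
  also have "\<dots> \<le> (\<Sum>i\<in>UNIV. \<Sum>j\<in>UNIV. lam i * P i j / mu i j)"
    using nonneg by (intro member_le_sum[of i UNIV "\<lambda>i. \<Sum>j\<in>UNIV. lam i * P i j / mu i j"] sum_nonneg) auto
  also have "\<dots> \<le> travel_load mu P Q lam"
  proof -
    have "(\<Sum>k\<in>UNIV. lam k * P k i) * Q i j / mu i j \<ge> 0" for i j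
      using lam mu PQ by (intro divide_nonneg_pos mult_nonneg_nonneg sum_nonneg) (auto intro: less_imp_le)
    then show ?thesis by (simp add: travel_load_def sum_nonneg)
  qed
  finally show ?thesis .
qed

section \<open>Availability\<close>

lemma pmf_of_weights:
  fixes w :: "'a \<Rightarrow> real"
  assumes "finite S" and w: "\<And>s. s \<in> S \<Longrightarrow> w s \<ge> 0" and pos: "(\<Sum>s\<in>S. w s) > 0"
  obtains p where "set_pmf p \<subseteq> S" and "\<And>s. s \<in> S \<Longrightarrow> pmf p s = w s / (\<Sum>s\<in>S. w s)"
proof -
  define f where "f s = (if s \<in> S then w s / (\<Sum>s\<in>S. w s) else 0)" for s
  have f: "f s \<ge> 0" for s using w pos by (simp add: f_def)
  have "(\<integral>\<^sup>+s. f s \<partial>count_space UNIV) = (\<integral>\<^sup>+s. f s \<partial>count_space S)"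
    by (intro nn_integral_count_space_eq) (auto simp: f_def)
  also have "\<dots> = (\<Sum>s\<in>S. ennreal (f s))"
    using assms(1) by (rule nn_integral_count_space_finite)
  also have "\<dots> = ennreal (\<Sum>s\<in>S. f s)" using f by (intro sum_ennreal)
  also have "(\<Sum>s\<in>S. f s) = 1"
    using pos by (simp add: f_def sum_divide_distrib[symmetric])
  finally have int: "(\<integral>\<^sup>+s. f s \<partial>count_space UNIV) = 1" by simp
  have pmf: "pmf (embed_pmf f) s = f s" for s
    by (rule pmf_embed_pmf[OF f int])
  show thesis
    by (rule that[of "embed_pmf f"]) (auto simp: set_pmf_iff pmf f_def split: if_splits)
qed

definition single_servers :: "(('r \<times> 'r) + ('r \<times> 'r)) set" where
  "single_servers = range (\<lambda>i. Inl (i, i))"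

definition travel_rate :: "('r \<Rightarrow> 'r \<Rightarrow> real) \<Rightarrow> ('r \<times> 'r) + ('r \<times> 'r) \<Rightarrow> real" where
  "travel_rate mu a = (case a of Inl (i, j) \<Rightarrow> mu i j | Inr (i, j) \<Rightarrow> mu i j)"

lemma card_single_servers: "card (single_servers :: (('r::finite \<times> 'r) + ('r \<times> 'r)) set) = CARD('r)"
  unfolding single_servers_def by (rule card_image) (auto intro: injI)

lemma service_rate_travel:
  "a \<notin> single_servers \<Longrightarrow> service_rate lam mu N a l = travel_rate mu a * real l"
  by (auto simp: single_servers_def service_rate_def travel_rate_def split: sum.split)

lemma sum_travel_load:
  "(\<Sum>a\<in>-single_servers. flow P Q x a / travel_rate mu a) = travel_load mu P Q x"
proof -
  have Inl: "Inl (i, j) \<in> (single_servers :: (('a \<times> 'a) + ('a \<times> 'a)) set) \<longleftrightarrow> i = j"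
    and Inr: "Inr (i, j) \<notin> (single_servers :: (('a \<times> 'a) + ('a \<times> 'a)) set)" for i j :: 'a
    by (auto simp: single_servers_def)
  let ?h = "\<lambda>a. if a \<in> single_servers then 0 else flow P Q x a / travel_rate mu a"
  have 1: "(\<Sum>j\<in>UNIV. ?h (Inl (i, j))) =
      (\<Sum>j\<in>UNIV - {i}. (\<Sum>k\<in>UNIV. x k * P k i) * Q i j / mu i j)" for i
    by (rule sum.mono_neutral_cong_right) (auto simp: Inl flow_def travel_rate_def)
  have 2: "?h (Inr (i, j)) = x i * P i j / mu i j" for i j
    by (simp add: Inr flow_def travel_rate_def)
  have "(\<Sum>a\<in>-single_servers. flow P Q x a / travel_rate mu a) = sum ?h UNIV"
    by (rule sum.mono_neutral_cong_left) auto
  also have "\<dots> = (\<Sum>i\<in>UNIV. \<Sum>j\<in>UNIV. ?h (Inl (i, j))) + (\<Sum>i\<in>UNIV. \<Sum>j\<in>UNIV. ?h (Inr (i, j)))"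
    unfolding sum_UNIV_sum[of ?h] sum_UNIV_prod[of "\<lambda>a. ?h (Inl a)"] sum_UNIV_prod[of "\<lambda>a. ?h (Inr a)"] ..
  finally show ?thesis unfolding 1 2 travel_load_def by simp
qed

text \<open>\<open>N\<close> fixes the rates and \<open>n\<close> is the population; the ratio of
  the values at \<open>n = N - 1\<close> and \<open>n = N\<close> is what matters.\<close>

definition partition_function where
  "partition_function lam mu P Q N x n =
     (\<Sum>m\<in>confs n. weight (flow P Q x) (service_rate lam mu N) m)"

context
  fixes lam :: "'r::finite \<Rightarrow> real" and mu P Q :: "'r \<Rightarrow> 'r \<Rightarrow> real"
    and x :: "'r \<Rightarrow> real"
  assumes lam: "\<And>i. lam i > 0" and mu: "\<And>i j. mu i j > 0"
    and P: "row_stochastic P" and Q: "row_stochastic Q"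
    and x: "\<And>i. x i \<ge> 0" and x_nontrivial: "\<exists>i. x i \<noteq> 0"
    and balanced: "balanced_flow P Q x"
begin

lemma flow_nonneg: "flow P Q x a \<ge> 0"
proof -
  have "P i j \<ge> 0" "Q i j \<ge> 0" for i j using P Q by (auto simp: row_stochastic_def)
  then show ?thesis
    by (auto simp: flow_def x split: sum.split intro!: mult_nonneg_nonneg sum_nonneg)
qed

lemma service_rate_nonneg: "service_rate lam mu N a l \<ge> 0"
  using lam mu by (auto simp: service_rate_def less_imp_le split: sum.split)

lemma product_form_weight_nonneg: "weight (flow P Q x) (service_rate lam mu N) m \<ge> 0"
  by (intro weight_nonneg flow_nonneg service_rate_nonneg)

lemma partition_function_pos: "partition_function lam mu P Q (Suc M) x n > 0"
proof -
  obtain i where i: "x i > 0" using x_nontrivial x by (metis order_le_less)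
  define m :: "('r \<times> 'r) + ('r \<times> 'r) \<Rightarrow> nat" where "m = (\<lambda>a. if a = Inl (i, i) then n else 0)"
  have "weight (flow P Q x) (service_rate lam mu (Suc M)) m > 0"
    unfolding weight_def
  proof (intro prod_pos ballI)
    fix a l assume "l \<in> {..<m a}"
    then have "a = Inl (i, i)" by (auto simp: m_def split: if_splits)
    then show "flow P Q x a / service_rate lam mu (Suc M) a (Suc l) > 0"
      using i lam by (simp add: flow_def service_rate_def)
  qed
  moreover have "m \<in> confs n" by (simp add: confs_def m_def)
  ultimately show ?thesis
    unfolding partition_function_def
    by (intro sum_pos2[of _ m]) (auto intro: product_form_weight_nonneg)
qed

text \<open>After division by the partition function for \<open>Suc M\<close> cars, this is the mean
  rate at which cars leave station \<open>a\<close>.\<close>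

lemma mean_service:
  "(\<Sum>n\<in>confs (Suc M). weight (flow P Q x) (service_rate lam mu (Suc M)) n * service_rate lam mu (Suc M) a (n a))
   = flow P Q x a * partition_function lam mu P Q (Suc M) x M"
proof -
  have "service_rate lam mu (Suc M) a 0 = 0" "\<And>l. service_rate lam mu (Suc M) a (Suc l) \<noteq> 0"
    using lam mu by (auto simp: service_rate_def less_imp_neq[symmetric] split: sum.split)
  from sum_confs_shift[where H = "\<lambda>_. 1" and y = "flow P Q x" and \<phi> = "service_rate lam mu (Suc M)" and a = a and M = M, OF this] show ?thesis
    by (simp add: partition_function_def)
qed

text \<open>An infinite-server station holds on average its mean service rate divided by the rate
  per car, so \<open>travel_load\<close> times the ratio of partition functions is the mean number
  of travelling cars, at most the fleet size.\<close>

lemma travel_load_le: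
  "travel_load mu P Q x * partition_function lam mu P Q (Suc M) x M
   \<le> real (Suc M) * partition_function lam mu P Q (Suc M) x (Suc M)"
proof -
  define w where "w n = weight (flow P Q x) (service_rate lam mu (Suc M)) n" for n
  have "flow P Q x a / travel_rate mu a * partition_function lam mu P Q (Suc M) x M =
      (\<Sum>n\<in>confs (Suc M). w n * real (n a))" if "a \<notin> single_servers" for a
  proof -
    have "travel_rate mu a > 0" using mu by (auto simp: travel_rate_def split: sum.split)
    moreover have "(\<Sum>n\<in>confs (Suc M). w n * (travel_rate mu a * real (n a))) =
        flow P Q x a * partition_function lam mu P Q (Suc M) x M"
      using mean_service[of M a] that by (simp add: w_def service_rate_travel)
    then have "travel_rate mu a * (\<Sum>n\<in>confs (Suc M). w n * real (n a)) =
        flow P Q x a * partition_function lam mu P Q (Suc M) x M"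
      by (simp add: sum_distrib_left mult_ac)
    ultimately show ?thesis by (simp add: field_simps)
  qed
  then have "travel_load mu P Q x * partition_function lam mu P Q (Suc M) x M =
      (\<Sum>a\<in>-single_servers. \<Sum>n\<in>confs (Suc M). w n * real (n a))"
    unfolding sum_travel_load[symmetric] sum_distrib_right by (intro sum.cong) auto
  also have "\<dots> = (\<Sum>n\<in>confs (Suc M). \<Sum>a\<in>-single_servers. w n * real (n a))" by (rule sum.swap)
  also have "\<dots> \<le> (\<Sum>n\<in>confs (Suc M). w n * real (Suc M))"
  proof (rule sum_mono)
    fix n :: "('r \<times> 'r) + ('r \<times> 'r) \<Rightarrow> nat" assume n: "n \<in> confs (Suc M)"
    have "(\<Sum>a\<in>-single_servers. n a) \<le> sum n UNIV" by (intro sum_mono2) auto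
    then have "real (\<Sum>a\<in>-single_servers. n a) \<le> real (Suc M)"
      using n by (simp only: confs_def mem_Collect_eq of_nat_le_iff)
    then have "w n * real (\<Sum>a\<in>-single_servers. n a) \<le> w n * real (Suc M)"
      unfolding w_def by (intro mult_left_mono product_form_weight_nonneg)
    then show "(\<Sum>a\<in>-single_servers. w n * real (n a)) \<le> w n * real (Suc M)"
      by (simp add: sum_distrib_left)
  qed
  also have "\<dots> = real (Suc M) * partition_function lam mu P Q (Suc M) x (Suc M)"
    by (simp only: partition_function_def w_def sum_distrib_left mult.commute)
  finally show ?thesis .
qed

text \<open>The queue of region \<open>i\<close> serves at rate \<open>N * lam i\<close> exactly
  when it is occupied, so its availability is its mean service rate divided by
  \<open>N * lam i\<close>.\<close>

lemma availability_product_form: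
  assumes single: "single_recurrent_class lam mu P Q (Suc M)"
  shows "availability lam mu P Q (Suc M) i = x i / (real (Suc M) * lam i) *
    (partition_function lam mu P Q (Suc M) x M / partition_function lam mu P Q (Suc M) x (Suc M))"
proof -
  define w where "w s = state_weight lam mu P Q x (Suc M) s" for s
  define Z where "Z = partition_function lam mu P Q (Suc M) x (Suc M)"
  have Z: "(\<Sum>s\<in>states (Suc M). w s) = Z"
    unfolding sum_states_eq_sum_confs Z_def partition_function_def w_def by simp
  have Zpos: "Z > 0" unfolding Z_def by (rule partition_function_pos)
  obtain p where p: "set_pmf p \<subseteq> states (Suc M)"
    and pmf: "\<And>s. s \<in> states (Suc M) \<Longrightarrow> pmf p s = w s / Z"
    using pmf_of_weights[of "states (Suc M)" w] Zpos unfolding Z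
    by (metis finite_states product_form_weight_nonneg w_def)
  have stat: "stationary lam mu P Q (Suc M) p"
    unfolding stationary_def
  proof (intro conjI ballI p)
    fix t :: "'r state" assume t: "t \<in> states (Suc M)"
    have "(\<Sum>s\<in>states (Suc M). pmf p s * jump_rate lam mu P Q (Suc M) s t) =
        (\<Sum>s\<in>states (Suc M). w s * jump_rate lam mu P Q (Suc M) s t) / Z"
      by (simp add: pmf sum_divide_distrib)
    also have "(\<Sum>s\<in>states (Suc M). w s * jump_rate lam mu P Q (Suc M) s t) =
        w t * (\<Sum>u\<in>states (Suc M). jump_rate lam mu P Q (Suc M) t u)"
      unfolding w_def
      by (rule product_form_balance[OF lam mu P Q balanced[unfolded balanced_flow_def, rule_format] t])
    finally show "(\<Sum>s\<in>states (Suc M). pmf p s * jump_rate lam mu P Q (Suc M) s t) =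
        pmf p t * (\<Sum>u\<in>states (Suc M). jump_rate lam mu P Q (Suc M) t u)"
      by (simp add: pmf t)
  qed
  \<comment> \<open>Uniqueness is what lets the definite description be evaluated.\<close>
  have "(THE p. stationary lam mu P Q (Suc M) p) = p"
    using stat stationary_unique[OF lam mu P Q single] by (intro the_equality) auto
  then have "availability lam mu P Q (Suc M) i = measure_pmf.prob p {(E, F). E (i, i) > 0}"
    by (simp add: availability_def)
  also have "\<dots> = measure_pmf.prob p (states (Suc M) \<inter> {(E, F). E (i, i) > 0})"
    using p by (intro measure_prob_cong_0) (auto simp: set_pmf_iff)
  also have "\<dots> = (\<Sum>s\<in>states (Suc M) \<inter> {(E, F). E (i, i) > 0}. pmf p s)"
    by (rule measure_measure_pmf_finite) simp
  also have "\<dots> = (\<Sum>s\<in>states (Suc M). pmf p s * of_bool (fst s (i, i) > 0))"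
    by (rule sum.mono_neutral_cong_left) auto
  also have "\<dots> = (\<Sum>s\<in>states (Suc M).
      w s * service_rate lam mu (Suc M) (Inl (i, i)) (conf_of s (Inl (i, i))) / (real (Suc M) * lam i * Z))"
  proof (rule sum.cong[OF refl])
    fix s :: "'r state" assume "s \<in> states (Suc M)"
    then show "pmf p s * of_bool (fst s (i, i) > 0) = 
      w s * service_rate lam mu (Suc M) (Inl (i, i)) (conf_of s (Inl (i, i))) / (real (Suc M) * lam i * Z)"
      using lam[of i] by (simp add: pmf service_rate_def conf_of_def del: of_nat_Suc)
  qed
  also have "\<dots> = (\<Sum>n\<in>confs (Suc M). weight (flow P Q x) (service_rate lam mu (Suc M)) n *
      service_rate lam mu (Suc M) (Inl (i, i)) (n (Inl (i, i)))) / (real (Suc M) * lam i * Z)"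
    unfolding sum_divide_distrib[symmetric] sum_states_eq_sum_confs w_def conf_of_state_of ..
  also have "\<dots> = x i * partition_function lam mu P Q (Suc M) x M / (real (Suc M) * lam i * Z)"
    unfolding mean_service by (simp add: flow_def)
  finally show ?thesis by (simp add: Z_def)
qed

end

text \<open>Availabilities are proportional to \<open>x i / lam i\<close> with a factor common to
  all regions. If all tend to \<open>1\<close>, then \<open>x\<close> is proportional to
  \<open>lam\<close>, and the bound on the mean number of travelling cars passes to the
  limit.\<close>

lemma perfect_availability_imp_balanced_flow:
  assumes lam: "\<And>i. lam i > 0" and mu: "\<And>i j. mu i j > 0"
    and P: "row_stochastic P" and Q: "row_stochastic Q"
    and avail: "achieves_perfect_availability lam mu P Q"
  shows "balanced_flow P Q lam" and "travel_load mu P Q lam \<le> 1"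
proof -
  define K where "K i j = (\<Sum>k\<in>UNIV. P i k * Q k j)" for i j
  have PQ: "P i j \<ge> 0" "Q i j \<ge> 0" "(\<Sum>j\<in>UNIV. P i j) = 1" "(\<Sum>j\<in>UNIV. Q i j) = 1" for i j
    using P Q by (auto simp: row_stochastic_def)
  have "(\<Sum>j\<in>UNIV. K i j) = 1" for i
  proof -
    have "(\<Sum>j\<in>UNIV. K i j) = (\<Sum>k\<in>UNIV. \<Sum>j\<in>UNIV. P i k * Q k j)"
      unfolding K_def by (rule sum.swap)
    then show ?thesis by (simp add: sum_distrib_left[symmetric] PQ)
  qed
  then have "row_stochastic K"
    using PQ by (auto simp: row_stochastic_def K_def intro!: sum_nonneg)
  then obtain x where x: "\<And>i. x i \<ge> 0" and x1: "(\<Sum>i\<in>UNIV. x i) = 1"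
    and xK: "\<And>i. x i = (\<Sum>j\<in>UNIV. x j * K j i)"
    by (rule stochastic_matrix_invariant) blast
  have "(\<Sum>j\<in>UNIV. x j * K j i) = (\<Sum>j\<in>UNIV. (\<Sum>k\<in>UNIV. x k * P k j) * Q j i)" for i
    unfolding K_def sum_distrib_left sum_distrib_right mult.assoc by (rule sum.swap)
  then have bal: "balanced_flow P Q x" unfolding balanced_flow_def using xK by metis
  have nontriv: "\<exists>i. x i \<noteq> 0" using x1 by (metis sum.neutral zero_neq_one)
  define g where "g M = partition_function lam mu P Q (Suc M) x M /
      partition_function lam mu P Q (Suc M) x (Suc M) / real (Suc M)" for M
  have av: "availability lam mu P Q (Suc M) i = x i / lam i * g M" for M i
  proof -
    have "single_recurrent_class lam mu P Q (Suc M)"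
      using avail unfolding achieves_perfect_availability_def by simp
    from availability_product_form[OF lam mu P Q x nontriv bal this, of i] show ?thesis
      by (simp add: g_def)
  qed
  define \<Lambda> where "\<Lambda> = (\<Sum>i\<in>UNIV. lam i)"
  have xg: "(\<lambda>M. x i * g M) \<longlonglongrightarrow> lam i" for i
  proof -
    have "(\<lambda>N. availability lam mu P Q N i) \<longlonglongrightarrow> 1"
      using avail by (simp add: achieves_perfect_availability_def)
    then have "(\<lambda>M. lam i * availability lam mu P Q (Suc M) i) \<longlonglongrightarrow> lam i * 1"
      by (intro tendsto_mult tendsto_const LIMSEQ_Suc)
    then show ?thesis using lam[of i] by (simp add: av)
  qed
  have "(\<lambda>M. \<Sum>i\<in>UNIV. x i * g M) \<longlonglongrightarrow> \<Lambda>"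
    unfolding \<Lambda>_def by (intro tendsto_sum xg)
  \<comment> \<open>The normalisation of \<open>x\<close> isolates the common factor when the limits
    are summed over the regions.\<close>
  then have g: "g \<longlonglongrightarrow> \<Lambda>" by (simp add: sum_distrib_right[symmetric] x1)
  have lam_x: "lam i = \<Lambda> * x i" for i
    using LIMSEQ_unique[OF xg[of i] tendsto_mult[OF tendsto_const g]] by (simp add: mult.commute)
  then have lam_eq: "lam = (\<lambda>i. \<Lambda> * x i)" by blast
  show "balanced_flow P Q lam"
    by (subst lam_eq) (rule balanced_flow_scale[OF bal])
  have "travel_load mu P Q x * g M \<le> 1" for M
    using travel_load_le[OF lam mu P Q x nontriv bal, where M = M]
      partition_function_pos[OF lam mu P Q x nontriv bal, where M = M and n = "Suc M"]
    by (simp add: g_def field_simps del: of_nat_Suc)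
  then have "travel_load mu P Q x * \<Lambda> \<le> 1"
    using LIMSEQ_le_const2[OF tendsto_mult[OF tendsto_const g]] by blast
  then show "travel_load mu P Q lam \<le> 1"
    by (subst lam_eq) (simp add: travel_load_scale mult.commute)
qed

text \<open>With throughputs \<open>N * lam i\<close> every queue is saturated, the prefactor of the
  availability is \<open>1\<close>, and the partition function is a coefficient of
  \<open>geo\<close> powers times an exponential series.\<close>

lemma balanced_flow_imp_perfect_availability:
  fixes lam :: "'r::finite \<Rightarrow> real"
  assumes lam: "\<And>i. lam i > 0" and mu: "\<And>i j. mu i j > 0"
    and P: "row_stochastic P" and Q: "row_stochastic Q"
    and single: "\<And>N. N \<ge> 1 \<Longrightarrow> single_recurrent_class lam mu P Q N"
    and bal: "balanced_flow P Q lam" and load: "travel_load mu P Q lam \<le> 1"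
  shows "achieves_perfect_availability lam mu P Q"
  unfolding achieves_perfect_availability_def
proof (intro conjI allI impI single)
  fix i
  define \<rho> where "\<rho> = travel_load mu P Q lam"
  define x where "x M = (\<lambda>i. real (Suc M) * lam i)" for M
  have x: "x M j \<ge> 0" "\<exists>j. x M j \<noteq> 0" "balanced_flow P Q (x M)" for M j
    using lam balanced_flow_scale[OF bal] by (auto simp: x_def less_imp_le less_imp_neq[symmetric] simp del: of_nat_Suc)
  \<comment> \<open>One region is split off because the limit lemma speaks of
    \<open>geo ^ Suc r\<close>.\<close>
  obtain r where r: "CARD('r) = Suc r" using not0_implies_Suc[of "CARD('r)"] by auto
  have Z: "partition_function lam mu P Q (Suc M) (x M) n =
      fps_nth (geo ^ Suc r * fps_exp (real (Suc M) * \<rho>)) n" for M n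
  proof -
    have "partition_function lam mu P Q (Suc M) (x M) n =
        fps_nth (geo ^ card (single_servers :: (('r \<times> 'r) + ('r \<times> 'r)) set) *
          fps_exp (\<Sum>a\<in>-single_servers. flow P Q (x M) a / travel_rate mu a)) n"
      unfolding partition_function_def
    proof (rule sum_weight_confs)
      fix a :: "('r \<times> 'r) + ('r \<times> 'r)" and l
      assume a: "a \<in> single_servers"
      then show "service_rate lam mu (Suc M) a (Suc l) = flow P Q (x M) a"
        by (auto simp: single_servers_def service_rate_def flow_def x_def)
      show "flow P Q (x M) a \<noteq> 0"
        using a lam by (auto simp: single_servers_def flow_def x_def less_imp_neq[symmetric] simp del: of_nat_Suc)
    qed (rule service_rate_travel)
    then show ?thesis
      unfolding sum_travel_load card_single_servers r by (simp only: x_def travel_load_scale \<rho>_def)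
  qed
  have "availability lam mu P Q (Suc M) i = fps_nth (geo ^ Suc r * fps_exp (real (Suc M) * \<rho>)) M /
      fps_nth (geo ^ Suc r * fps_exp (real (Suc M) * \<rho>)) (Suc M)" for M
  proof -
    have "x M i / (real (Suc M) * lam i) = 1" using lam[of i] by (simp add: x_def del: of_nat_Suc)
    then show ?thesis
      using availability_product_form[OF lam mu P Q x(1)[where M = M] x(2)[where M = M] x(3)[where M = M] single, of M i] by (simp only: Z mult_1_left)
  qed
  moreover have "\<rho> \<ge> 0" "\<rho> \<le> 1"
    using load travel_load_pos[OF lam mu P Q] by (simp_all add: \<rho>_def less_imp_le)
  ultimately have "(\<lambda>M. availability lam mu P Q (Suc M) i) \<longlonglongrightarrow> 1"
    using geo_exp_ratio_tendsto[of \<rho> r] by simp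
  then show "(\<lambda>N. availability lam mu P Q N i) \<longlonglongrightarrow> 1" by (rule LIMSEQ_imp_Suc)
qed

section \<open>The theorem\<close>

theorem mainTheorem7:
  fixes lam :: "'r::finite \<Rightarrow> real" and mu P :: "'r \<Rightarrow> 'r \<Rightarrow> real"
  assumes "\<And>i. lam i > 0" and "\<And>i j. mu i j > 0" and "row_stochastic P"
  shows "(\<exists>q f e. lp_feasible lam mu P q f e) \<and>
    (\<exists>\<kappa>>0. lp_optimal_value lam mu P \<kappa> \<and>
      ((\<forall>i j k. i \<noteq> j \<and> j \<noteq> k \<longrightarrow> 1 / mu i k \<le> 1 / mu i j + 1 / mu j k) \<longrightarrow>
         (\<kappa> > 1 \<longrightarrow>
            \<not> perfect_availability_feasible lam mu P \<and>
            (optimal_policy_single_recurrent_class lam mu P \<longrightarrow>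
               perfect_availability_feasible (\<lambda>i. lam i / \<kappa>) mu P)) \<and>
         (\<kappa> \<le> 1 \<longrightarrow>
            (optimal_policy_single_recurrent_class lam mu P \<longrightarrow>
               perfect_availability_feasible lam mu P \<and>
               perfect_availability_feasible (\<lambda>i. lam i / \<kappa>) mu P))))"
proof -
  obtain q where q: "row_stochastic q" "balanced_flow P q lam"
    and min: "\<And>q'. row_stochastic q' \<Longrightarrow> balanced_flow P q' lam \<Longrightarrow>
      travel_load mu P q lam \<le> travel_load mu P q' lam"
    by (rule travel_load_minimum[where lam = lam and mu = mu, OF assms(1,3)], rule that)
  define \<kappa> where "\<kappa> = travel_load mu P q lam"
  have \<kappa>: "\<kappa> > 0" unfolding \<kappa>_def by (rule travel_load_pos[where lam = lam and mu = mu, OF assms q(1)])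
  obtain f e where fe: "lp_feasible lam mu P q f e"
    using lp_feasible_exists[where lam = lam and mu = mu, OF assms(2) q] by blast
  have objective: "lp_objective f e = \<kappa>"
    unfolding \<kappa>_def by (rule lp_feasible_flow(3)[where lam = lam and mu = mu, OF fe assms(2)])
  have bound: "\<kappa> \<le> lp_objective f' e'" if "lp_feasible lam mu P q' f' e'" for q' f' e'
    unfolding \<kappa>_def lp_feasible_flow(3)[where lam = lam and mu = mu, OF that assms(2)]
    by (rule min[OF lp_feasible_flow(1,2)[where lam = lam and mu = mu, OF that assms(2)]])
  have optimal: "lp_optimal_value lam mu P \<kappa>"
    unfolding lp_optimal_value_def lp_optimal_def using fe objective bound by blast
  have infeasible: "\<not> perfect_availability_feasible lam mu P" if "\<kappa> > 1"
  proof
    assume "perfect_availability_feasible lam mu P"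
    then obtain Q where Q: "row_stochastic Q" "achieves_perfect_availability lam mu P Q"
      unfolding perfect_availability_feasible_def by blast
    note flow = perfect_availability_imp_balanced_flow[where lam = lam and mu = mu, OF assms(1,2,3) Q]
    have "\<kappa> \<le> travel_load mu P Q lam" unfolding \<kappa>_def by (rule min[OF Q(1) flow(1)])
    with flow(2) that show False by simp
  qed
  \<comment> \<open>Both positive claims are instances: \<open>c = \<kappa>\<close> for the rescaled
    rates, and \<open>c = 1\<close> for the given ones when \<open>\<kappa> \<le> 1\<close>.\<close>
  have feasible: "perfect_availability_feasible (\<lambda>i. lam i / c) mu P"
    if single: "optimal_policy_single_recurrent_class lam mu P" and c: "c \<ge> \<kappa>" for c
  proof -
    obtain Q f' e' where opt: "lp_optimal lam mu P Q f' e'"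
      and rec: "\<And>N. N \<ge> 1 \<Longrightarrow> single_recurrent_class lam mu P Q N"
      using single unfolding optimal_policy_single_recurrent_class_def by blast
    have lp: "lp_feasible lam mu P Q f' e'" using opt unfolding lp_optimal_def by blast
    note Q = lp_feasible_flow[where lam = lam and mu = mu, OF lp assms(2)]
    \<comment> \<open>\<open>Q\<close> is the optimal policy supplied by the recurrence assumption
      and may differ from \<open>q\<close>; optimality bounds its load by that of
      \<open>q\<close>.\<close>
    have "travel_load mu P Q lam \<le> \<kappa>"
      using opt fe objective unfolding lp_optimal_def Q(3)[symmetric] by blast
    then have load: "1 / c * travel_load mu P Q lam \<le> 1" using c \<kappa> by simp
    have c_pos: "c > 0" using c \<kappa> by simp
    have scaled: "(\<lambda>i. lam i / c) = (\<lambda>i. 1 / c * lam i)" by simp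
    have "achieves_perfect_availability (\<lambda>i. lam i / c) mu P Q"
    proof (rule balanced_flow_imp_perfect_availability[where mu = mu, OF _ assms(2,3) Q(1)])
      show "lam i / c > 0" for i using assms(1) c_pos by simp
      show "single_recurrent_class (\<lambda>i. lam i / c) mu P Q N" if "N \<ge> 1" for N
        unfolding single_recurrent_class_scale[where lam = lam and mu = mu, OF assms Q(1) c_pos] by (rule rec[OF that])
      show "balanced_flow P Q (\<lambda>i. lam i / c)"
        unfolding scaled by (rule balanced_flow_scale[OF Q(2)])
      show "travel_load mu P Q (\<lambda>i. lam i / c) \<le> 1"
        unfolding scaled travel_load_scale by (rule load)
    qed
    with Q(1) show ?thesis unfolding perfect_availability_feasible_def by blast
  qed
  have feasible_self: "perfect_availability_feasible lam mu P"
    if "optimal_policy_single_recurrent_class lam mu P" "\<kappa> \<le> 1"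
    using feasible[OF that] by simp
  show ?thesis
  proof (intro conjI exI[of _ \<kappa>] impI)
    show "\<exists>q f e. lp_feasible lam mu P q f e" using fe by (intro exI)
  qed (fact \<kappa> optimal | rule infeasible feasible feasible_self order_refl; assumption?)+
qed

end
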